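(* For every $n\ge3$, the number of realizable words of length $2n$ is $$\#\mathcal{W}_n=3^n-2^{n+1}+1.$$ As a consequence, the exponential growth rate of the number of realizable bracelets is equal to $3$, that is, $\#\mathcal{B}_n=3^{n(1+o(1))}$ as $n\to\infty$.
   Context: Let $n\ge 3$ and let $P_1,\ldots,P_n$ be $n$ distinct points on the unit circle of the complex plane in counterclockwise cyclic order; let $L_i$ be the perpendicular bisector of $[P_i,P_{i+1}]$ (indices modulo $n$). Assume generic position: the lines $L_i$ are pairwise distinct, no $P_j$ lies on any $L_i$, and the point $1$ lies on no $L_i$. The lines divide the plane into $2n$ regions, numbered counterclockwise starting with the region containing $1$; the occupancy word is $(v_1,\ldots,v_{2n})\in\{0,1\}^{2n}$ where $v_i$ is the number of points $P_j$ in the $i$th region (always $0$ or $1$). A word in $\{0,1\}^{2n}$ is realizable if it is the occupancy word of some such generic collection. A bracelet is an equivalence class of words up to cyclic shifts and reversal; a realizable bracelet is the class of a realizable word. $\mathcal{W}_n$ (resp. $\mathcal{B}_n$) denotes the set of realizable words (resp. bracelets) of length $2n$. *)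

theory Defs
  imports "HOL-Analysis.Analysis" "HOL-Library.Landau_Symbols"
begin

text \<open>
  Points and regions are indexed from \<open>0\<close>: the points by \<open>{..<n}\<close>, the regions by
  \<open>{..<2 * n}\<close>. The values of \<open>P\<close> outside \<open>{..<n}\<close> are irrelevant.
\<close>

text \<open>
  \<open>ccw_on_circle m z\<close> says that \<open>z 0, \<dots>, z (m - 1)\<close> lie on the unit circle, are
  pairwise distinct, and are met in this order during a single counterclockwise turn
  starting at \<open>z 0\<close>.
\<close>

definition ccw_on_circle :: "nat \<Rightarrow> (nat \<Rightarrow> complex) \<Rightarrow> bool" where
  "ccw_on_circle m z \<longleftrightarrow>
     (\<exists>\<theta> :: nat \<Rightarrow> real. strict_mono_on {..<m} \<theta> \<and>
        (\<forall>i<m. \<theta> i < \<theta> 0 + 2 * pi \<and> z i = cis (\<theta> i)))"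

definition bisector :: "complex \<Rightarrow> complex \<Rightarrow> complex set" where
  "bisector a b = {z. dist z a = dist z b}"

definition bisector_line :: "nat \<Rightarrow> (nat \<Rightarrow> complex) \<Rightarrow> nat \<Rightarrow> complex set" where
  "bisector_line n P i = bisector (P i) (P (Suc i mod n))"

definition generic :: "nat \<Rightarrow> (nat \<Rightarrow> complex) \<Rightarrow> bool" where
  "generic n P \<longleftrightarrow>
     ccw_on_circle n P \<and>
     inj_on (bisector_line n P) {..<n} \<and>
     (\<forall>i<n. \<forall>j<n. P j \<notin> bisector_line n P i) \<and>
     (\<forall>i<n. 1 \<notin> bisector_line n P i)"

definition regions :: "nat \<Rightarrow> (nat \<Rightarrow> complex) \<Rightarrow> complex set set" where
  "regions n P = components (- (\<Union>i<n. bisector_line n P i))"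

text \<open>
  The regions of a generic collection are open sectors with apex \<open>0\<close>, so their cyclic order
  is that of any choice of one point of the unit circle in each of them.
\<close>

definition region_numbering ::
    "nat \<Rightarrow> (nat \<Rightarrow> complex) \<Rightarrow> (nat \<Rightarrow> complex set) \<Rightarrow> bool" where
  "region_numbering n P R \<longleftrightarrow>
     bij_betw R {..<2 * n} (regions n P) \<and>
     1 \<in> R 0 \<and>
     (\<exists>z. ccw_on_circle (2 * n) z \<and> (\<forall>k<2 * n. z k \<in> R k))"

definition occupancy :: "nat \<Rightarrow> (nat \<Rightarrow> complex) \<Rightarrow> (nat \<Rightarrow> complex set) \<Rightarrow> nat list" where
  "occupancy n P R = map (\<lambda>k. card {j. j < n \<and> P j \<in> R k}) [0..<2 * n]"

definition binary_words :: "nat \<Rightarrow> nat list set" where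
  "binary_words m = {w. length w = m \<and> set w \<subseteq> {0, 1}}"

definition realizable_words :: "nat \<Rightarrow> nat list set" where
  "realizable_words n =
     {w \<in> binary_words (2 * n).
        \<exists>P R. generic n P \<and> region_numbering n P R \<and> w = occupancy n P R}"

definition bracelet_rel :: "('a list \<times> 'a list) set" where
  "bracelet_rel = {(u, v). \<exists>k. v = rotate k u \<or> v = rotate k (rev u)}"

lemma equiv_bracelet_rel: "equiv UNIV bracelet_rel"
proof -
  have unrot: "\<exists>j. rotate j (rotate k u) = u" for k and u :: "'a list"
  proof (cases "u = []")
    case False
    have "k * (length u - 1) + k = k * length u"
      using False by (cases "length u") auto
    then have "rotate (k * (length u - 1)) (rotate k u) = u"
      by (simp add: rotate_rotate)
    then show ?thesis by blast
  qed simp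
  have rev_rot: "\<exists>j. rev (rotate k u) = rotate j (rev u)" for k and u :: "'a list"
    by (metis rotate_rev rev_rev_ident)
  have "refl (bracelet_rel :: ('a list \<times> 'a list) set)"
    unfolding refl_on_def bracelet_rel_def by (auto intro: exI[of _ 0])
  moreover have "sym (bracelet_rel :: ('a list \<times> 'a list) set)"
    unfolding sym_def bracelet_rel_def by clarsimp (metis unrot rev_rot rev_rev_ident)
  moreover have "trans (bracelet_rel :: ('a list \<times> 'a list) set)"
    unfolding trans_def bracelet_rel_def by clarsimp (metis rotate_rotate rev_rot rev_rev_ident)
  ultimately show ?thesis by (simp add: equiv_def)
qed

definition realizable_bracelets :: "nat \<Rightarrow> nat list set set" where
  "realizable_bracelets n = realizable_words n // bracelet_rel"

end

theory Submission imports Defs begin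

text \<open>
  Modulo \<open>pi\<close> the points and the bisecting lines form one cyclic pattern. On the circle itself
  points and midpoints alternate, and so do their antipodes, hence just after a line the number
  of points met exceeds the number of lines met by a height \<open>D\<close> that takes only two consecutive
  values. So among the antipodal pairs of regions, the full ones and the empty ones alternate.
  They cannot both be missing: then the half gaps between the points, whose lengths add up to
  \<open>pi\<close>, would tile the circle modulo \<open>pi\<close> and put the antipode of a point on a line.

  Conversely, from a word with a nonconstant \<open>D\<close> one builds points whose successive distances
  shrink geometrically while \<open>D = 0\<close> and grow geometrically while \<open>D = 1\<close>. The midpoint of
  two consecutive points is then next to its left end in the first case and next to its
  right end in the second, as the word demands. A small perturbation makes the lines distinct.

  The closed walks of \<open>D\<close> are counted by the trace of the \<open>n\<close>th power of the transfer matrix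
  with rows \<open>(2, 1)\<close> and \<open>(1, 2)\<close>, whose eigenvalues are \<open>3\<close> and \<open>1\<close>; each of
  the two constant walks accounts for \<open>2 ^ n\<close> excluded words.
\<close>

section \<open>Sectors cut out by lines through the origin\<close>

text \<open>Angles are lifted to the reals and sectors are indexed by integers, so a half turn
  becomes a shift by \<open>n\<close>, and the occupancy word records indices modulo
  \<open>2 * n\<close>. The height \<open>D\<close> never reaches 2 for the following reason: by
  floor y + floor (y + 1/2) = floor (2 y), the excess of points over lines modulo \<open>pi\<close>
  is the excess on the circle at an angle plus that at its antipode. Each is 0 or 1, and at a line
  one of the two angles is a midpoint, where the excess is 0. The converse never locates the lines.
  Every integer \<open>k\<close> gets a slot \<open>pos k\<close>, occupied or not, and the region
  number of a point is the count of points minus the two excesses, up to a constant. Geometry only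
  has to tell, for an empty slot opposite a point, on which side of the midpoint of its two
  neighbouring points it falls. The ratio 2 of the gaps settles this: a decreasing geometric series
  of ratio 1/2 sums to less than the term before it, so the next point on the shrinking side is
  nearer than even the adjacent slot on the other side.\<close>

lemma sin_eq_0_iff_floor: "sin t = 0 \<longleftrightarrow> t = of_int \<lfloor>t / pi\<rfloor> * pi"
proof
  assume "sin t = 0"
  then obtain i :: int where "t = of_int i * pi" using sin_zero_iff_int2 by blast
  then show "t = of_int \<lfloor>t / pi\<rfloor> * pi" by simp
qed (metis sin_zero_iff_int2)

lemma sin_shift_eq_0_iff: "sin (t + of_int a * pi) = 0 \<longleftrightarrow> sin t = 0"
proof -
  have "sin (t + of_int a * pi) = 0" if "sin t = 0" for t and a :: int
  proof -
    from that obtain i :: int where "t = of_int i * pi" using sin_zero_iff_int2 by blast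
    then have "t + of_int a * pi = of_int (i + a) * pi" by (simp add: algebra_simps)
    then show ?thesis using sin_zero_iff_int2 by blast
  qed
  from this[of t a] this[of "t + of_int a * pi" "- a"] show ?thesis by auto
qed

lemma floor_shift_pi: "\<lfloor>(t + of_int a * pi) / pi\<rfloor> = \<lfloor>t / pi\<rfloor> + a"
  by (simp add: add_divide_distrib)

lemma floor_jump: "s < t \<Longrightarrow> sin t = 0 \<Longrightarrow> \<lfloor>s / pi\<rfloor> < \<lfloor>t / pi\<rfloor>"
proof -
  assume "s < t" "sin t = 0"
  then have "s / pi < t / pi" "t / pi = of_int \<lfloor>t / pi\<rfloor>"
    using sin_eq_0_iff_floor[of t] by (auto simp: field_simps)
  then show ?thesis by linarith
qed

text \<open>Counts, with a normalisation, the angles congruent to some \<open>m i\<close> modulo \<open>pi\<close> up to \<open>t\<close>.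
  On the angles that lie on no line it numbers the sectors.\<close>

definition floor_count :: "nat \<Rightarrow> (nat \<Rightarrow> real) \<Rightarrow> real \<Rightarrow> int" where
  "floor_count n m t = (\<Sum>i<n. \<lfloor>(t - m i) / pi\<rfloor>)"

locale line_system =
  fixes n :: nat and m :: "nat \<Rightarrow> real"
  assumes n_pos: "0 < n"
    and distinct: "\<lbrakk>i < n; j < n; i \<noteq> j\<rbrakk> \<Longrightarrow> sin (m i - m j) \<noteq> 0"
begin

definition is_line :: "real \<Rightarrow> bool" where
  "is_line t \<longleftrightarrow> (\<exists>i<n. sin (t - m i) = 0)"

abbreviation L :: "real \<Rightarrow> int" where
  "L \<equiv> floor_count n m"

lemma is_line_shift [simp]: "is_line (t + of_int a * pi) \<longleftrightarrow> is_line t"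
proof -
  have "sin (t + of_int a * pi - m i) = 0 \<longleftrightarrow> sin (t - m i) = 0" for i
    using sin_shift_eq_0_iff[of "t - m i" a] by (simp add: algebra_simps)
  then show ?thesis by (simp add: is_line_def)
qed

lemma L_shift: "L (t + of_int a * pi) = L t + a * int n"
proof -
  have "\<lfloor>(t + of_int a * pi - m i) / pi\<rfloor> = \<lfloor>(t - m i) / pi\<rfloor> + a" for i
    using floor_shift_pi[of "t - m i" a] by (simp add: algebra_simps)
  then show ?thesis by (simp add: floor_count_def sum.distrib)
qed

lemma is_line_2pi: "is_line (t + 2 * pi * of_int a) \<longleftrightarrow> is_line t"
  using is_line_shift[of t "2 * a"] by (simp add: algebra_simps)

lemma L_2pi: "L (t + 2 * pi * of_int a) = L t + a * (2 * int n)"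
  using L_shift[of t "2 * a"] by (simp add: algebra_simps)

lemma L_mono: "s \<le> t \<Longrightarrow> L s \<le> L t"
  unfolding floor_count_def by (intro sum_mono floor_mono divide_right_mono) auto

lemma L_less_line:
  assumes "s < t" "is_line t" shows "L s < L t"
proof -
  from assms obtain i where i: "i < n" "sin (t - m i) = 0" by (auto simp: is_line_def)
  have "\<lfloor>(s - m i) / pi\<rfloor> < \<lfloor>(t - m i) / pi\<rfloor>" using assms i by (intro floor_jump) auto
  moreover have "\<lfloor>(s - m j) / pi\<rfloor> \<le> \<lfloor>(t - m j) / pi\<rfloor>" for j
    using assms by (intro floor_mono divide_right_mono) auto
  ultimately show ?thesis unfolding floor_count_def using i by (intro sum_strict_mono_ex1) auto
qed

lemma is_line_m: "i < n \<Longrightarrow> is_line (m i)"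
  by (auto simp: is_line_def intro: exI[of _ i])

text \<open>Equal residues make the counts equal after a shift by a multiple of \<open>pi\<close>.
  Since \<open>L\<close> jumps at every line, two line angles with the same count coincide, and
  \<open>distinct\<close> applies.\<close>

lemma L_m_mod_inj: "inj_on (\<lambda>i. (L (m i) - c) mod int n) {..<n}"
proof (rule inj_onI)
  fix i j assume ij: "i \<in> {..<n}" "j \<in> {..<n}" "(L (m i) - c) mod int n = (L (m j) - c) mod int n"
  then have "int n dvd (L (m i) - c) - (L (m j) - c)" using mod_eq_dvd_iff by blast
  then obtain a where a: "L (m i) = L (m j) + a * int n" by (auto simp: dvd_def algebra_simps)
  then have e: "L (m i) = L (m j + of_int a * pi)" using L_shift by simp
  have "is_line (m j + of_int a * pi)" "is_line (m i)" using ij is_line_m by auto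
  then have "m i = m j + of_int a * pi" using e L_less_line by (metis less_irrefl linorder_neqE)
  then have "sin (m i - m j) = 0" using sin_zero_iff_int2[of "m i - m j"] by auto
  then show "i = j" using distinct ij by blast
qed

lemma bij_L_m_mod: "bij_betw (\<lambda>i. (L (m i) - c) mod int n) {..<n} {0..<int n}"
  unfolding bij_betw_def
proof
  show "(\<lambda>i. (L (m i) - c) mod int n) ` {..<n} = {0..<int n}"
    by (rule card_subset_eq) (use n_pos in \<open>auto simp: card_image[OF L_m_mod_inj]\<close>)
qed (rule L_m_mod_inj)

text \<open>The \<open>n\<close> lines exhaust the residues modulo \<open>n\<close>, so one of them
  has the residue of \<open>c\<close>; half turns then adjust its count to \<open>c\<close>
  itself.\<close>

lemma ex1_line: "\<exists>!t. is_line t \<and> L t = c"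
proof -
  have "0 \<in> {0..<int n}" using n_pos by simp
  then obtain i where i: "i < n" "(L (m i) - c) mod int n = 0"
    using bij_L_m_mod[of c] unfolding bij_betw_def by (metis (no_types, lifting) imageE lessThan_iff)
  then obtain a where a: "L (m i) - c = int n * a" by (auto simp: mod_eq_0_iff_dvd dvd_def)
  have "is_line (m i + of_int (- a) * pi)" using is_line_m[OF i(1)] is_line_shift by blast
  moreover have "L (m i + of_int (- a) * pi) = c" using L_shift[of "m i" "- a"] a
    by (simp add: algebra_simps)
  moreover have "s = t" if "is_line s \<and> L s = c" "is_line t \<and> L t = c" for s t
    using that L_less_line by (metis less_irrefl linorder_neqE)
  ultimately show ?thesis by blast
qed

text \<open>The increasing enumeration, over all integers, of the angles lying on lines.
  \<open>L\<close> counts a line at its own angle, so the angles of count \<open>c\<close> start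
  with \<open>line_angle c\<close>.\<close>

definition line_angle :: "int \<Rightarrow> real" where
  "line_angle c = (THE t. is_line t \<and> L t = c)"

lemma line_angle: "is_line (line_angle c)" "L (line_angle c) = c"
  using theI'[OF ex1_line[of c]] by (simp_all add: line_angle_def)

lemma line_angle_eqI: "is_line t \<Longrightarrow> L t = c \<Longrightarrow> line_angle c = t"
  using ex1_line line_angle by blast

lemma line_angle_shift: "line_angle (c + a * int n) = line_angle c + of_int a * pi"
  using line_angle[of c] L_shift by (intro line_angle_eqI) auto

lemma line_angle_strict: "c < d \<Longrightarrow> line_angle c < line_angle d"
  using line_angle L_mono by (metis not_less)

lemma sector_iff: "\<not> is_line t \<and> L t = c \<longleftrightarrow> t \<in> {line_angle c<..<line_angle (c + 1)}"
proof
  assume t: "\<not> is_line t \<and> L t = c"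
  have "t \<noteq> line_angle c" "t \<noteq> line_angle (c + 1)" using t line_angle by metis+
  moreover have "\<not> t < line_angle c" using L_less_line[of t "line_angle c"] line_angle[of c] t by auto
  moreover have "\<not> line_angle (c + 1) < t" using L_mono[of "line_angle (c+1)" t] line_angle[of "c+1"] t by auto
  ultimately show "t \<in> {line_angle c<..<line_angle (c + 1)}" by auto
next
  assume t: "t \<in> {line_angle c<..<line_angle (c + 1)}"
  then have "L t \<ge> c" using L_mono[of "line_angle c" t] line_angle by auto
  moreover have "L t < c + 1" using t L_less_line[of t "line_angle (c+1)"] line_angle by auto
  moreover have "\<not> is_line t" using t L_less_line[of "line_angle c" t] calculation line_angle(2)[of c] by auto
  ultimately show "\<not> is_line t \<and> L t = c" by auto
qed

definition sector :: "int \<Rightarrow> complex set" where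
  "sector c = {rcis r t | r t. 0 < r \<and> \<not> is_line t \<and> L t = c}"

text \<open>The angle of a point is determined only up to full turns, and each full turn changes
  \<open>L\<close> by \<open>2 * n\<close>; this is where the modulus comes from.\<close>

lemma rcis_in_sector:
  assumes "0 < r"
  shows "rcis r t \<in> sector c \<longleftrightarrow> \<not> is_line t \<and> (L t - c) mod (2 * int n) = 0"
proof
  assume "rcis r t \<in> sector c"
  then obtain q s where s: "rcis r t = rcis q s" "0 < q" "\<not> is_line s" "L s = c"
    unfolding sector_def by blast
  have "q = r" using s(1,2) assms by (metis abs_of_pos complex_mod_rcis)
  then have "cis t = cis s" using s assms by (simp add: rcis_def)
  then have "sin t = sin s \<and> cos t = cos s" by (metis cis.sel)
  then obtain a :: int where "t = s + 2 * pi * of_int a" by (auto simp: sin_cos_eq_iff)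
  then show "\<not> is_line t \<and> (L t - c) mod (2 * int n) = 0" using s by (simp add: is_line_2pi L_2pi)
next
  assume t: "\<not> is_line t \<and> (L t - c) mod (2 * int n) = 0"
  then obtain a where a: "L t - c = 2 * int n * a" by (auto simp: mod_eq_0_iff_dvd dvd_def)
  have "rcis r t = rcis r (t + 2 * pi * of_int (- a))"
  proof -
    have "cos (2 * pi * of_int (- a)) = 1" "sin (2 * pi * of_int (- a)) = 0"
      by (rule cos_int_2pin, rule sin_int_2pin)
    then have "cis (t + 2 * pi * of_int (- a)) = cis t"
      by (simp only: complex_eq_iff cis.sel cos_add sin_add) simp
    then show ?thesis by (simp add: rcis_def)
  qed
  moreover have "L (t + 2 * pi * of_int (- a)) = c" using L_2pi[of t "- a"] a by (simp add: algebra_simps)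
  moreover have "\<not> is_line (t + 2 * pi * of_int (- a))" using is_line_2pi t by blast
  ultimately show "rcis r t \<in> sector c" unfolding sector_def using assms by blast
qed

lemma cis_in_sector: "cis t \<in> sector c \<longleftrightarrow> \<not> is_line t \<and> (L t - c) mod (2 * int n) = 0"
  using rcis_in_sector[of 1 t c] by (simp add: rcis_def)

lemma sector_nonempty: "sector c \<noteq> {}"
proof -
  have "line_angle c < line_angle (c + 1)" by (simp add: line_angle_strict)
  then obtain t where "line_angle c < t" "t < line_angle (c + 1)"
    using dense by blast
  then have "\<not> is_line t \<and> L t = c" by (simp add: sector_iff)
  then have "cis t \<in> sector c" by (simp add: cis_in_sector)
  then show ?thesis by blast
qed

lemma sector_eq_image: "sector c = (\<lambda>(r, t). rcis r t) ` ({0<..} \<times> {line_angle c<..<line_angle (c + 1)})"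
  unfolding sector_def using sector_iff[of _ c] by (auto 0 4 simp: image_iff)

lemma connected_sector: "connected (sector c)"
  unfolding sector_eq_image rcis_def case_prod_unfold cis_conv_exp
  by (intro connected_continuous_image continuous_intros connected_Times) auto

lemma line_angle_gap: "line_angle (c + 1) \<le> line_angle c + pi"
proof -
  have "c + 1 \<le> c + 1 * int n" using n_pos by simp
  then have "line_angle (c + 1) \<le> line_angle (c + 1 * int n)"
    using line_angle_strict by (metis order_le_less)
  also have "\<dots> = line_angle c + pi" using line_angle_shift[of c 1] by simp
  finally show ?thesis .
qed

lemma open_sector: "open (sector c)"
proof -
  define a b where "a = line_angle c" and "b = line_angle (c + 1)"
  \<comment> \<open>Turning by \<open>- s\<close> centres the sector on the positive real axis. As
    it is at most \<open>pi\<close> wide, it avoids the cut of \<open>Arg\<close> and becomes an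
    open preimage of an interval.\<close>
  define s where "s = (a + b) / 2"
  have ab: "a < b" "b \<le> a + pi" using line_angle_gap line_angle_strict by (auto simp: a_def b_def)
  define U where "U = {z. z * cis (- s) \<notin> \<real>\<^sub>\<le>\<^sub>0}"
  have U: "open U"
  proof -
    have "U = (\<lambda>z. z * cis (- s)) -` (- \<real>\<^sub>\<le>\<^sub>0)" by (simp add: U_def vimage_def set_eq_iff)
    then show ?thesis by (simp only:) (intro open_vimage continuous_intros, simp add: open_Compl)
  qed
  have cont: "continuous_on U (\<lambda>z. s + Arg (z * cis (- s)))"
    by (rule continuous_on_subset[of "{z. z * cis (- s) \<notin> \<real>\<^sub>\<le>\<^sub>0}"])
       (auto simp: U_def intro!: continuous_intros)
  have "sector c = U \<inter> (\<lambda>z. s + Arg (z * cis (- s))) -` {a<..<b}"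
  proof (intro set_eqI iffI)
    fix z assume "z \<in> sector c"
    then obtain r t where z: "z = rcis r t" "0 < r" "a < t" "t < b"
      unfolding sector_eq_image a_def b_def by (clarsimp simp only: image_iff) force
    have e: "z * cis (- s) = rcis r (t - s)" using z by (simp add: rcis_def cis_mult)
    have "t - s \<in> {-pi<..<pi}" using z ab by (auto simp: s_def field_simps)
    then have A: "Arg (z * cis (- s)) = t - s" using z e by (auto intro!: Arg_rcis)
    have "z * cis (- s) \<notin> \<real>\<^sub>\<le>\<^sub>0"
    proof
      assume "z * cis (- s) \<in> \<real>\<^sub>\<le>\<^sub>0"
      then obtain x where x: "x \<le> 0" "z * cis (- s) = of_real x" by (auto elim: nonpos_Reals_cases)
      then have "x < 0" using z e by (cases "x = 0") auto
      then have "Arg (z * cis (- s)) = pi" using x by (simp add: Arg_of_real)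
      then show False using A \<open>t - s \<in> {-pi<..<pi}\<close> by auto
    qed
    then show "z \<in> U \<inter> (\<lambda>z. s + Arg (z * cis (- s))) -` {a<..<b}" using A z by (auto simp: U_def)
  next
    fix z assume z: "z \<in> U \<inter> (\<lambda>z. s + Arg (z * cis (- s))) -` {a<..<b}"
    define t where "t = s + Arg (z * cis (- s))"
    have "z = rcis (cmod z) t"
    proof -
      have "z * cis (- s) = rcis (cmod z) (t - s)"
        using rcis_cmod_Arg[of "z * cis (- s)"] by (simp add: t_def norm_mult)
      then have "z * cis (- s) * cis s = rcis (cmod z) (t - s) * cis s" by simp
      then show ?thesis by (simp add: rcis_def cis_mult mult.assoc)
    qed
    moreover have "0 < cmod z" using z by (auto simp: U_def)
    moreover have "t \<in> {a<..<b}" using z by (auto simp: t_def)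
    ultimately show "z \<in> sector c" unfolding sector_eq_image a_def b_def by force
  qed
  then show ?thesis using continuous_open_preimage[OF cont U] by simp
qed

definition line :: "nat \<Rightarrow> complex set" where
  "line i = {z. Im (z * cis (- m i)) = 0}"

lemma rcis_in_line: "0 < r \<Longrightarrow> rcis r t \<in> line i \<longleftrightarrow> sin (t - m i) = 0"
proof -
  assume "0 < r"
  have "rcis r t * cis (- m i) = rcis r (t - m i)" by (simp add: rcis_def mult.assoc cis_mult)
  then show ?thesis using \<open>0 < r\<close> by (simp only: line_def mem_Collect_eq Im_rcis) simp
qed

lemma Union_sectors: "- (\<Union>i<n. line i) = (\<Union>c\<in>{L 0..<L 0 + 2 * int n}. sector c)"
proof (intro set_eqI iffI)
  fix z assume z: "z \<in> - (\<Union>i<n. line i)"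
  have "z \<noteq> 0" using z n_pos by (auto simp: line_def)
  define t where "t = Arg z"
  have zt: "z = rcis (cmod z) t" by (simp add: t_def rcis_cmod_Arg)
  have "\<not> is_line t" using z zt \<open>z \<noteq> 0\<close> rcis_in_line[of "cmod z" t] by (auto simp: is_line_def)
  define c where "c = L 0 + (L t - L 0) mod (2 * int n)"
  have "(L t - c) mod (2 * int n) = 0" unfolding c_def
    by (metis diff_diff_add minus_mod_eq_mult_div mod_mult_self1_is_0)
  then have "z \<in> sector c" using zt \<open>z \<noteq> 0\<close> \<open>\<not> is_line t\<close> rcis_in_sector[of "cmod z" t c] by auto
  moreover have "c \<in> {L 0..<L 0 + 2 * int n}" using n_pos by (auto simp: c_def)
  ultimately show "z \<in> (\<Union>c\<in>{L 0..<L 0 + 2 * int n}. sector c)" by blast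
next
  fix z assume "z \<in> (\<Union>c\<in>{L 0..<L 0 + 2 * int n}. sector c)"
  then obtain r t where "z = rcis r t" "0 < r" "\<not> is_line t" by (auto simp: sector_def)
  then show "z \<in> - (\<Union>i<n. line i)" using rcis_in_line by (auto simp: is_line_def)
qed

lemma sector_disjoint:
  assumes "c \<in> {L 0..<L 0 + 2 * int n}" "d \<in> {L 0..<L 0 + 2 * int n}" "z \<in> sector c" "z \<in> sector d"
  shows "c = d"
proof -
  from assms(3) obtain r t where z: "z = rcis r t" "0 < r" "\<not> is_line t" "L t = c"
    by (auto simp: sector_def)
  then have "(c - d) mod (2 * int n) = 0" using rcis_in_sector assms(4) by blast
  then have "2 * int n dvd c - d" by (simp add: mod_eq_0_iff_dvd)
  moreover have "\<bar>c - d\<bar> < 2 * int n" using assms by auto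
  ultimately show ?thesis using zdvd_not_zless[of "\<bar>c - d\<bar>" "2 * int n"] by auto
qed

end

text \<open>A connected set containing \<open>A i\<close> cannot leave it, because the union of the
  other pieces is open and disjoint from \<open>A i\<close>.\<close>

lemma components_disjoint_open:
  fixes A :: "'i \<Rightarrow> 'a::topological_space set"
  assumes "\<And>i. i \<in> I \<Longrightarrow> open (A i) \<and> connected (A i) \<and> A i \<noteq> {}"
    and disj: "\<And>i j x. \<lbrakk>i \<in> I; j \<in> I; x \<in> A i; x \<in> A j\<rbrakk> \<Longrightarrow> i = j"
  shows "components (\<Union>i\<in>I. A i) = A ` I"
proof -
  have *: "A i \<in> components (\<Union>i\<in>I. A i)" if i: "i \<in> I" for i
    unfolding in_components_maximal
  proof (intro conjI allI impI)
    fix D assume D: "D \<noteq> {} \<and> A i \<subseteq> D \<and> D \<subseteq> (\<Union>i\<in>I. A i) \<and> connected D"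
    let ?B = "\<Union>j\<in>I - {i}. A j"
    have "open (A i)" "open ?B" using assms(1) i by auto
    moreover have cover: "D \<subseteq> A i \<union> ?B" using D by auto
    moreover have "A i \<inter> ?B \<inter> D = {}" using disj i by auto
    moreover have "A i \<inter> D \<noteq> {}" using D assms(1)[OF i] by auto
    ultimately have "?B \<inter> D = {}" using connectedD[of D "A i" ?B] D by metis
    then show "D = A i" using D cover by blast
  qed (use assms(1) i in auto)
  show ?thesis
  proof (intro set_eqI iffI)
    fix C assume C: "C \<in> components (\<Union>i\<in>I. A i)"
    then obtain x where x: "x \<in> C" using in_components_nonempty by blast
    then obtain i where i: "i \<in> I" "x \<in> A i" using C in_components_subset by blast
    have "C = A i" using components_eq[OF C *[OF i(1)]] x i by blast
    then show "C \<in> A ` I" using i by blast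
  qed (use * in auto)
qed

section \<open>Occupancy words of points on the circle\<close>

text \<open>The difference of the squared distances factors by the sum-to-product formulas into
  \<open>sin ((b - a) / 2)\<close> times a linear form vanishing in the direction
  \<open>(a + b) / 2\<close>.\<close>

lemma bisector_cis:
  assumes "sin ((b - a) / 2) \<noteq> 0"
  shows "bisector (cis a) (cis b) = {z. Im (z * cis (- ((a + b) / 2))) = 0}"
proof -
  have "dist z (cis a) = dist z (cis b) \<longleftrightarrow> Im (z * cis (- ((a + b) / 2))) = 0" for z
  proof -
    have sq: "(dist z (cis t))\<^sup>2 = (cmod z)\<^sup>2 + 1 - 2 * (Re z * cos t + Im z * sin t)" for t
    proof -
      have "(dist z (cis t))\<^sup>2 = (Re z - cos t)\<^sup>2 + (Im z - sin t)\<^sup>2"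
        by (simp add: dist_norm cmod_power2)
      also have "\<dots> = (Re z)\<^sup>2 + (Im z)\<^sup>2 + ((sin t)\<^sup>2 + (cos t)\<^sup>2) - 2 * (Re z * cos t + Im z * sin t)"
        by (simp only: power2_eq_square) algebra
      finally show ?thesis by (simp add: cmod_power2)
    qed
    have "dist z (cis a) = dist z (cis b) \<longleftrightarrow> (dist z (cis a))\<^sup>2 = (dist z (cis b))\<^sup>2"
      by (simp add: power2_eq_iff_nonneg)
    also have "\<dots> \<longleftrightarrow> Re z * (cos a - cos b) + Im z * (sin a - sin b) = 0"
      unfolding sq by (auto simp: algebra_simps)
    also have "Re z * (cos a - cos b) + Im z * (sin a - sin b) =
        2 * sin ((b - a) / 2) * (Re z * sin ((a + b) / 2) - Im z * cos ((a + b) / 2))"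
    proof -
      have "sin ((a - b) / 2) = - sin ((b - a) / 2)"
        by (metis minus_diff_eq minus_divide_left sin_minus)
      then show ?thesis by (simp only: cos_diff_cos sin_diff_sin) (simp add: algebra_simps)
    qed
    also have "\<dots> = 0 \<longleftrightarrow> Im (z * cis (- ((a + b) / 2))) = 0"
      using assms by auto
    finally show ?thesis .
  qed
  then show ?thesis by (simp add: bisector_def)
qed

text \<open>The index is not reduced modulo \<open>n\<close>: later \<open>\<theta> n\<close> is the
  first angle one turn further, which makes the last midpoint the right one.\<close>

definition mid :: "(nat \<Rightarrow> real) \<Rightarrow> nat \<Rightarrow> real" where
  "mid \<theta> i = (\<theta> i + \<theta> (Suc i)) / 2"

text \<open>Hermite's identity for two terms. It will split a count modulo \<open>pi\<close> into
  the counts modulo \<open>2 * pi\<close> at an angle and at its antipode.\<close>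

lemma floor_half: "\<lfloor>y\<rfloor> + \<lfloor>y + 1/2\<rfloor> = \<lfloor>2 * y\<rfloor>" for y :: real
proof (cases "y - of_int \<lfloor>y\<rfloor> < 1/2")
  case True
  then have "\<lfloor>y + 1/2\<rfloor> = \<lfloor>y\<rfloor>" "\<lfloor>2 * y\<rfloor> = 2 * \<lfloor>y\<rfloor>" by linarith+
  then show ?thesis by simp
next
  case False
  then have "\<lfloor>y + 1/2\<rfloor> = \<lfloor>y\<rfloor> + 1" "\<lfloor>2 * y\<rfloor> = 2 * \<lfloor>y\<rfloor> + 1" by linarith+
  then show ?thesis by simp
qed

lemma strict_mono_int_id:
  fixes f :: "nat \<Rightarrow> int"
  assumes "\<And>i j. i < j \<Longrightarrow> j < N \<Longrightarrow> f i < f j"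
    and "\<And>i. i < N \<Longrightarrow> 0 \<le> f i \<and> f i < int N" and "k < N"
  shows "f k = int k"
proof -
  have *: "f i + int d \<le> f (i + d)" if "i + d < N" for i d
    using that
  proof (induction d)
    case (Suc d)
    then have "f (i + d) < f (i + Suc d)" using assms(1) by auto
    with Suc show ?case by auto
  qed simp
  have "f 0 + int k \<le> f k" using *[of 0 k] assms(3) by simp
  moreover have "f k + int (N - 1 - k) \<le> f (N - 1)" using *[of k "N - 1 - k"] assms(3) by simp
  ultimately show ?thesis using assms(2)[of 0] assms(2)[of "N - 1"] assms(3)
    by (simp add: of_nat_diff)
qed

section \<open>Points and midpoints along one turn of the circle\<close>

locale circle_points =
  fixes n :: nat and \<theta> :: "nat \<Rightarrow> real"
  assumes n_ge: "2 \<le> n"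
    and mono_Suc: "i < n \<Longrightarrow> \<theta> i < \<theta> (Suc i)"
    and closed: "\<theta> n = \<theta> 0 + 2 * pi"
begin

lemma theta_less: "i < j \<Longrightarrow> j \<le> n \<Longrightarrow> \<theta> i < \<theta> j"
proof (induction j)
  case (Suc j)
  then show ?case using mono_Suc[of j] by (cases "i = j") auto
qed simp

lemma theta_le: "i \<le> j \<Longrightarrow> j \<le> n \<Longrightarrow> \<theta> i \<le> \<theta> j"
  using theta_less by (cases "i = j") (auto intro: less_imp_le)

lemma mid_between: "i < n \<Longrightarrow> \<theta> i < mid \<theta> i \<and> mid \<theta> i < \<theta> (Suc i)"
  using mono_Suc[of i] by (simp add: mid_def)

lemma gap_less: "i < n \<Longrightarrow> \<theta> (Suc i) - \<theta> i < 2 * pi"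
proof (cases "i = 0")
  case True
  then show ?thesis using theta_less[of 1 n] closed n_ge by simp
next
  assume i: "i < n" case False
  then show ?thesis using theta_less[of 0 i] theta_le[of "Suc i" n] closed i by simp
qed

lemma ccw: "\<forall>i<n. P i = cis (\<theta> i) \<Longrightarrow> ccw_on_circle n P"
  unfolding ccw_on_circle_def
  using theta_less theta_less[of _ n] closed by (intro exI[of _ \<theta>]) (auto simp: strict_mono_on_def)

lemma bisector_line_eq:
  assumes P: "\<forall>i<n. P i = cis (\<theta> i)" and i: "i < n"
  shows "bisector_line n P i = {z. Im (z * cis (- mid \<theta> i)) = 0}"
proof -
  have "cis (\<theta> n) = cis (\<theta> 0)" unfolding closed by (simp add: complex_eq_iff)
  then have "P (Suc i mod n) = cis (\<theta> (Suc i))"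
    using P i n_ge by (cases "Suc i = n") auto
  moreover have "sin ((\<theta> (Suc i) - \<theta> i) / 2) > 0"
    using gap_less[OF i] mono_Suc[OF i] by (intro sin_gt_zero) auto
  ultimately show ?thesis
    unfolding bisector_line_def mid_def using bisector_cis[of "\<theta> (Suc i)" "\<theta> i"] P i by auto
qed

lemma cis_in_bisector_line:
  assumes "\<forall>i<n. P i = cis (\<theta> i)" "i < n"
  shows "cis t \<in> bisector_line n P i \<longleftrightarrow> sin (t - mid \<theta> i) = 0"
  unfolding bisector_line_eq[OF assms] by (simp only: mem_Collect_eq cis_mult cis.sel) simp

text \<open>Points and midpoints alternate on the circle; \<open>drift t\<close> is \<open>1\<close> if the last of them met
  at \<open>t\<close> is a point, and \<open>0\<close> if it is a midpoint.\<close>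

definition drift :: "real \<Rightarrow> int" where
  "drift t = (\<Sum>i<n. \<lfloor>(t - \<theta> i) / (2 * pi)\<rfloor> - \<lfloor>(t - mid \<theta> i) / (2 * pi)\<rfloor>)"

lemma drift_terms:
  assumes "i < n"
  shows "\<lfloor>(t - mid \<theta> i) / (2 * pi)\<rfloor> \<le> \<lfloor>(t - \<theta> i) / (2 * pi)\<rfloor>"
    "\<lfloor>(t - \<theta> (Suc i)) / (2 * pi)\<rfloor> \<le> \<lfloor>(t - mid \<theta> i) / (2 * pi)\<rfloor>"
  using mid_between[OF assms] by (auto intro!: floor_mono divide_right_mono)

text \<open>The excess of midpoints over the following points complements \<open>drift\<close>:
  together they telescope over one full turn to 1. This gives the upper bound 1 just as the
  definition gives the lower bound 0.\<close>

lemma drift_alt: "drift t = 1 - (\<Sum>i<n. \<lfloor>(t - mid \<theta> i) / (2 * pi)\<rfloor> - \<lfloor>(t - \<theta> (Suc i)) / (2 * pi)\<rfloor>)"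
proof -
  have "drift t + (\<Sum>i<n. \<lfloor>(t - mid \<theta> i) / (2 * pi)\<rfloor> - \<lfloor>(t - \<theta> (Suc i)) / (2 * pi)\<rfloor>)
      = (\<Sum>i<n. \<lfloor>(t - \<theta> i) / (2 * pi)\<rfloor> - \<lfloor>(t - \<theta> (Suc i)) / (2 * pi)\<rfloor>)"
    unfolding drift_def by (simp add: sum.distrib[symmetric])
  also have "\<dots> = \<lfloor>(t - \<theta> 0) / (2 * pi)\<rfloor> - \<lfloor>(t - \<theta> n) / (2 * pi)\<rfloor>"
    by (rule sum_lessThan_telescope')
  also have "(t - \<theta> n) / (2 * pi) = (t - \<theta> 0) / (2 * pi) - 1"
    unfolding closed by (simp add: field_simps)
  finally show ?thesis by simp
qed

lemma drift_bounds: "0 \<le> drift t" "drift t \<le> 1"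
proof -
  show "0 \<le> drift t" unfolding drift_def using drift_terms by (intro sum_nonneg) auto
  have "0 \<le> (\<Sum>i<n. \<lfloor>(t - mid \<theta> i) / (2 * pi)\<rfloor> - \<lfloor>(t - \<theta> (Suc i)) / (2 * pi)\<rfloor>)"
    using drift_terms by (intro sum_nonneg) auto
  then show "drift t \<le> 1" unfolding drift_alt by simp
qed

text \<open>A single summand already reaches 1, the others are nonnegative, and the total is at most
  1. The lemma \<open>drift_eq_0\<close> is the mirror image through
  \<open>drift_alt\<close>.\<close>

lemma drift_eq_1:
  assumes "i < n" "\<theta> i + 2 * pi * of_int q \<le> t" "t < mid \<theta> i + 2 * pi * of_int q"
  shows "drift t = 1"
proof -
  have "of_int q \<le> (t - \<theta> i) / (2 * pi)" "(t - mid \<theta> i) / (2 * pi) < of_int q"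
    using assms by (auto simp: field_simps)
  then have "q \<le> \<lfloor>(t - \<theta> i) / (2 * pi)\<rfloor>" "\<lfloor>(t - mid \<theta> i) / (2 * pi)\<rfloor> < q"
    unfolding le_floor_iff floor_less_iff by auto
  then have "1 \<le> \<lfloor>(t - \<theta> i) / (2 * pi)\<rfloor> - \<lfloor>(t - mid \<theta> i) / (2 * pi)\<rfloor>" by linarith
  also have "\<dots> \<le> drift t" unfolding drift_def using drift_terms assms
    by (intro member_le_sum) auto
  finally show ?thesis using drift_bounds[of t] by simp
qed

lemma drift_eq_0:
  assumes "i < n" "mid \<theta> i + 2 * pi * of_int q \<le> t" "t < \<theta> (Suc i) + 2 * pi * of_int q"
  shows "drift t = 0"
proof -
  have "of_int q \<le> (t - mid \<theta> i) / (2 * pi)" "(t - \<theta> (Suc i)) / (2 * pi) < of_int q"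
    using assms by (auto simp: field_simps)
  then have "q \<le> \<lfloor>(t - mid \<theta> i) / (2 * pi)\<rfloor>" "\<lfloor>(t - \<theta> (Suc i)) / (2 * pi)\<rfloor> < q"
    unfolding le_floor_iff floor_less_iff by auto
  then have "1 \<le> \<lfloor>(t - mid \<theta> i) / (2 * pi)\<rfloor> - \<lfloor>(t - \<theta> (Suc i)) / (2 * pi)\<rfloor>" by linarith
  also have "\<dots> \<le> 1 - drift t" unfolding drift_alt using drift_terms assms
    by (subst diff_diff_eq2, simp, intro member_le_sum) auto
  finally show ?thesis using drift_bounds[of t] by simp
qed

text \<open>Passing an angle modulo \<open>pi\<close> means that either \<open>t\<close> or its
  antipode passes it modulo \<open>2 * pi\<close>; this is \<open>floor_half\<close>, term by
  term.\<close>

lemma floor_count_diff: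
  "floor_count n \<theta> t - floor_count n (mid \<theta>) t = drift t + drift (t + pi)"
proof -
  have *: "\<lfloor>(t - x) / pi\<rfloor> = \<lfloor>(t - x) / (2 * pi)\<rfloor> + \<lfloor>(t + pi - x) / (2 * pi)\<rfloor>" for x
  proof -
    have e: "(t + pi - x) / (2 * pi) = (t - x) / (2 * pi) + 1/2" "(t - x) / pi = 2 * ((t - x) / (2 * pi))"
      by (simp_all add: field_simps)
    show ?thesis unfolding e by (rule floor_half[symmetric])
  qed
  show ?thesis unfolding drift_def floor_count_def * by (simp add: sum.distrib sum_subtractf)
qed

end

section \<open>Regions, their numbering and the occupancy word of a generic collection\<close>

locale generic_points = circle_points n \<theta> + line_system n "mid \<theta>" for n \<theta> +
  assumes theta_not_line: "j < n \<Longrightarrow> \<not> is_line (\<theta> j)"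
begin

lemma genericI:
  assumes P: "\<forall>i<n. P i = cis (\<theta> i)" and "\<not> is_line 0"
  shows "generic n P"
proof -
  have "i = j" if "i < n" "j < n" "bisector_line n P i = bisector_line n P j" for i j
  proof (rule ccontr)
    assume "i \<noteq> j"
    have "cis (mid \<theta> i) \<in> bisector_line n P i"
      using cis_in_bisector_line[OF P that(1), of "mid \<theta> i"] by simp
    then have "cis (mid \<theta> i) \<in> bisector_line n P j" using that by simp
    then have "sin (mid \<theta> i - mid \<theta> j) = 0" using cis_in_bisector_line[OF P that(2)] by blast
    then show False using that distinct[of i j] \<open>i \<noteq> j\<close> by blast
  qed
  moreover have "P j \<notin> bisector_line n P i" if "i < n" "j < n" for i j
    using cis_in_bisector_line[OF P that(1), of "\<theta> j"] P that theta_not_line[of j]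
    by (auto simp: is_line_def)
  moreover have "1 \<notin> bisector_line n P i" if "i < n" for i
    using cis_in_bisector_line[OF P that, of 0] assms(2) that by (auto simp: is_line_def)
  ultimately show ?thesis using ccw[OF P] by (auto simp: generic_def inj_on_def)
qed

lemma regions_eq:
  assumes P: "\<forall>i<n. P i = cis (\<theta> i)"
  shows "regions n P = sector ` {L 0..<L 0 + 2 * int n}"
proof -
  have "(\<Union>i<n. bisector_line n P i) = (\<Union>i<n. line i)"
    using bisector_line_eq[OF P] by (simp add: line_def)
  then show ?thesis unfolding regions_def Union_sectors[symmetric]
    using components_disjoint_open[of "{L 0..<L 0 + 2 * int n}" sector]
      open_sector connected_sector sector_nonempty sector_disjoint Union_sectors
    by auto
qed

lemma region_numbering_sectors:
  assumes P: "\<forall>i<n. P i = cis (\<theta> i)" and "\<not> is_line 0"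
  shows "region_numbering n P (\<lambda>k. sector (L 0 + int k))"
proof -
  let ?R = "\<lambda>k. sector (L 0 + int k)"
  have "inj_on ?R {..<2 * n}"
  proof (rule inj_onI)
    fix i j assume "i \<in> {..<2 * n}" "j \<in> {..<2 * n}" "?R i = ?R j"
    then show "i = j"
      using sector_disjoint[of "L 0 + int i" "L 0 + int j"] sector_nonempty[of "L 0 + int i"] by auto
  qed
  moreover have "?R ` {..<2 * n} = regions n P"
  proof -
    have "(\<lambda>k. L 0 + int k) ` {..<2 * n} = {L 0..<L 0 + 2 * int n}"
    proof (intro set_eqI iffI)
      fix x assume "x \<in> {L 0..<L 0 + 2 * int n}"
      then show "x \<in> (\<lambda>k. L 0 + int k) ` {..<2 * n}"
        by (intro image_eqI[of _ _ "nat (x - L 0)"]) auto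
    qed auto
    then show ?thesis unfolding regions_eq[OF P] by (metis image_image)
  qed
  moreover have "1 \<in> ?R 0" using cis_in_sector[of 0 "L 0"] assms by simp
  moreover have "\<exists>z. ccw_on_circle (2 * n) z \<and> (\<forall>k<2 * n. z k \<in> ?R k)"
  proof -
    define s where "s c = (line_angle c + line_angle (c + 1)) / 2" for c
    have s: "line_angle c < s c" "s c < line_angle (c + 1)" for c
      using line_angle_strict[of c "c + 1"] by (auto simp: s_def)
    have L: "\<not> is_line (s c) \<and> L (s c) = c" for c using sector_iff s by simp
    have mono: "s c < s d" if "c < d" for c d
      using that s(2)[of c] s(1)[of d] line_angle_strict[of "c + 1" d]
      by (cases "c + 1 = d") auto
    have "s (L 0 + int k) < s (L 0 + int 0) + 2 * pi" if "k < 2 * n" for k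
    proof -
      have "s (L 0 + 2 * int n) = s (L 0) + 2 * pi"
        using line_angle_shift[of "L 0" 2] line_angle_shift[of "L 0 + 1" 2]
        by (simp add: s_def algebra_simps)
      then show ?thesis using mono[of "L 0 + int k" "L 0 + 2 * int n"] that by simp
    qed
    then have "ccw_on_circle (2 * n) (\<lambda>k. cis (s (L 0 + int k)))"
      unfolding ccw_on_circle_def using mono
      by (intro exI[of _ "\<lambda>k. s (L 0 + int k)"]) (auto simp: strict_mono_on_def)
    moreover have "\<forall>k<2 * n. cis (s (L 0 + int k)) \<in> ?R k" using L by (simp add: cis_in_sector)
    ultimately show ?thesis by blast
  qed
  ultimately show ?thesis by (auto simp: region_numbering_def bij_betw_def)
qed

text \<open>A numbering is known only through sample points in counterclockwise order. Their lifted
  angles increase within one turn, so the sector indices relative to the first one increase strictly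
  from 0 among \<open>2 * n\<close> values, which leaves only the identity.\<close>

lemma region_numbering_unique:
  assumes P: "\<forall>i<n. P i = cis (\<theta> i)" and R: "region_numbering n P R" and k: "k < 2 * n"
  shows "R k = sector (L 0 + int k)"
proof -
  have inj: "inj_on R {..<2 * n}" and reg: "\<And>k. k < 2 * n \<Longrightarrow> R k \<in> regions n P" and R0: "1 \<in> R 0"
    using R by (auto simp: region_numbering_def bij_betw_def)
  obtain \<zeta> where \<zeta>: "strict_mono_on {..<2 * n} \<zeta>" "\<And>k. k < 2 * n \<Longrightarrow> \<zeta> k < \<zeta> 0 + 2 * pi"
    "\<And>k. k < 2 * n \<Longrightarrow> cis (\<zeta> k) \<in> R k"
    using R unfolding region_numbering_def ccw_on_circle_def by metis
  have "\<exists>s. R k = sector (L 0 + s) \<and> 0 \<le> s \<and> s < 2 * int n" if k: "k < 2 * n" for k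
  proof -
    obtain c where "R k = sector c" "c \<in> {L 0..<L 0 + 2 * int n}"
      using reg[OF k] regions_eq[OF P] by auto
    then show ?thesis by (intro exI[of _ "c - L 0"]) auto
  qed
  then obtain s where s: "\<And>k. k < 2 * n \<Longrightarrow> R k = sector (L 0 + s k) \<and> 0 \<le> s k \<and> s k < 2 * int n"
    by metis
  have n2: "0 < 2 * n" using n_pos by simp
  have sm: "(L (\<zeta> k) - L 0) mod (2 * int n) = s k" if k: "k < 2 * n" for k
  proof -
    have "(L (\<zeta> k) - L 0 - s k) mod (2 * int n) = 0"
      using \<zeta>(3)[OF k] s[OF k] cis_in_sector[of "\<zeta> k" "L 0 + s k"] by (simp add: algebra_simps)
    then have "(L (\<zeta> k) - L 0) mod (2 * int n) = s k mod (2 * int n)"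
      by (simp add: mod_eq_dvd_iff mod_eq_0_iff_dvd)
    then show ?thesis using s[OF k] by simp
  qed
  have s0: "s 0 = 0"
  proof -
    have "cis 0 \<in> sector (L 0 + s 0)" using R0 s[OF n2] by simp
    then have "(- s 0) mod (2 * int n) = 0" using cis_in_sector[of 0 "L 0 + s 0"] by simp
    then have "2 * int n dvd s 0" by (simp add: mod_eq_0_iff_dvd)
    then show ?thesis using s[OF n2] zdvd_not_zless[of "s 0" "2 * int n"] by force
  qed
  have su: "L (\<zeta> k) - L (\<zeta> 0) = s k" if k: "k < 2 * n" for k
  proof (cases "k = 0")
    case False
    define u where "u = L (\<zeta> k) - L (\<zeta> 0)"
    have "s k \<noteq> 0" using inj_onD[OF inj, of k 0] s[OF k] s[OF n2] s0 k False by auto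
    have "\<zeta> 0 \<le> \<zeta> k" using \<zeta>(1) k False by (auto simp: strict_mono_on_def intro!: less_imp_le)
    then have "0 \<le> u" using L_mono by (simp add: u_def)
    \<comment> \<open>The bound obtained is not strict. The value \<open>2 * n\<close> would give
      \<open>s k = 0\<close>, which injectivity of \<open>R\<close> excludes.\<close>
    have "L (\<zeta> k) \<le> L (\<zeta> 0 + 2 * pi * of_int 1)" using \<zeta>(2)[OF k] by (intro L_mono) simp
    then have "u \<le> 2 * int n" unfolding L_2pi u_def by simp
    have "u = (L (\<zeta> k) - L 0) - (L (\<zeta> 0) - L 0)" by (simp add: u_def)
    then have "u mod (2 * int n) = (s k - s 0) mod (2 * int n)"
      using sm[OF k] sm[OF n2] by (metis mod_diff_eq)
    then have "u mod (2 * int n) = s k" using s0 s[OF k] by simp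
    then show ?thesis using \<open>0 \<le> u\<close> \<open>u \<le> 2 * int n\<close> \<open>s k \<noteq> 0\<close> unfolding u_def[symmetric]
      by (cases "u = 2 * int n") auto
  qed (simp add: s0)
  have "s k = int k"
  proof (rule strict_mono_int_id[of "2 * n"])
    fix i j assume ij: "i < j" "j < 2 * n"
    then have "\<zeta> i \<le> \<zeta> j" using \<zeta>(1) by (auto simp: strict_mono_on_def intro!: less_imp_le)
    then have "s i \<le> s j" using su[of i] su[of j] ij L_mono[of "\<zeta> i" "\<zeta> j"] by auto
    moreover have "s i \<noteq> s j" using inj_onD[OF inj, of i j] s[of i] s[of j] ij by auto
    ultimately show "s i < s j" by simp
  qed (use s k in auto)
  then show ?thesis using s[OF k] by simp
qed

lemma occupancy_eq:
  assumes P: "\<forall>i<n. P i = cis (\<theta> i)" and R: "region_numbering n P R"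
  shows "occupancy n P R =
    map (\<lambda>k. card {j. j < n \<and> (floor_count n (mid \<theta>) (\<theta> j) - L 0) mod (2 * int n) = int k}) [0..<2 * n]"
proof -
  have "P j \<in> R k \<longleftrightarrow> (L (\<theta> j) - L 0) mod (2 * int n) = int k" if "j < n" "k < 2 * n" for j k
  proof -
    have "P j \<in> R k \<longleftrightarrow> (L (\<theta> j) - (L 0 + int k)) mod (2 * int n) = 0"
      using region_numbering_unique[OF P R that(2)] P that theta_not_line cis_in_sector by simp
    also have "\<dots> \<longleftrightarrow> (L (\<theta> j) - L 0) mod (2 * int n) = int k mod (2 * int n)"
      by (simp add: mod_eq_dvd_iff mod_eq_0_iff_dvd algebra_simps)
    finally show ?thesis using that by simp
  qed
  then have "{j. j < n \<and> P j \<in> R k} = {j. j < n \<and> (L (\<theta> j) - L 0) mod (2 * int n) = int k}"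
    if "k < 2 * n" for k using that by auto
  then show ?thesis by (auto simp: occupancy_def)
qed

end

lemma generic_imp_generic_points:
  assumes "generic n P" "3 \<le> n"
  obtains \<theta> where "generic_points n \<theta>" "\<forall>i<n. P i = cis (\<theta> i)"
proof -
  from assms obtain \<theta>0 where t: "strict_mono_on {..<n} \<theta>0" "\<forall>i<n. \<theta>0 i < \<theta>0 0 + 2 * pi \<and> P i = cis (\<theta>0 i)"
    by (auto simp: generic_def ccw_on_circle_def)
  define \<theta> where "\<theta> i = (if i < n then \<theta>0 i else \<theta>0 0 + 2 * pi)" for i
  have P: "\<forall>i<n. P i = cis (\<theta> i)" using t by (simp add: \<theta>_def)
  interpret circle_points n \<theta>
    by unfold_locales (use assms t in \<open>auto simp: \<theta>_def strict_mono_on_def\<close>)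
  have d: "sin (mid \<theta> i - mid \<theta> j) \<noteq> 0" if "i < n" "j < n" "i \<noteq> j" for i j
  proof
    assume "sin (mid \<theta> i - mid \<theta> j) = 0"
    then obtain a :: int where a: "mid \<theta> i = mid \<theta> j + of_int a * pi"
      using sin_zero_iff_int2[of "mid \<theta> i - mid \<theta> j"] by (auto simp: algebra_simps)
    have "cis (- mid \<theta> i) = cis (- mid \<theta> j) * of_real (cos (of_int a * pi))"
    proof -
      have "cis (- mid \<theta> i) = cis (- mid \<theta> j) * cis (- (of_int a * pi))" unfolding a by (simp add: cis_mult)
      moreover have "sin (- (of_int a * pi)) = 0" by (metis sin_minus sin_zero_iff_int2 neg_equal_0_iff_equal)
      ultimately show ?thesis by (simp only: cis_def complex_eq_iff) simp
    qed
    moreover have "cos (of_int a * pi) \<noteq> 0"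
      using sin_cos_squared_add[of "of_int a * pi"] sin_zero_iff_int2[of "of_int a * pi"] by (metis power_zero_numeral add_0 zero_neq_one)
    ultimately have "Im (z * cis (- mid \<theta> i)) = 0 \<longleftrightarrow> Im (z * cis (- mid \<theta> j)) = 0" for z
      by (simp only: mult.assoc[symmetric]) (simp del: cis.sel)
    then have "bisector_line n P i = bisector_line n P j"
      using bisector_line_eq[OF P] that by simp
    then show False using assms that by (auto simp: generic_def inj_on_def)
  qed
  interpret line_system n "mid \<theta>" by unfold_locales (use d assms in auto)
  have "generic_points n \<theta>"
  proof unfold_locales
    fix j assume "j < n"
    then show "\<not> is_line (\<theta> j)"
      using cis_in_bisector_line[OF P, of _ "\<theta> j"] assms P by (auto simp: is_line_def generic_def)
  qed
  then show ?thesis using P that by blast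
qed

section \<open>Necessary conditions on realizable words\<close>

text \<open>Discrete analogue of \<open>floor_count\<close>: the number, up to a normalisation, of
  integers not above \<open>e\<close> that are congruent modulo \<open>n\<close> to some
  \<open>\<kappa> j\<close>, with multiplicity.\<close>

definition div_sum :: "nat \<Rightarrow> (nat \<Rightarrow> int) \<Rightarrow> int \<Rightarrow> int" where
  "div_sum n \<kappa> e = (\<Sum>j<n. (e - \<kappa> j) div int n)"

lemma div_plus1: "0 < N \<Longrightarrow> (x + 1) div N = x div N + (if (x + 1) mod N = 0 then 1 else 0)" for x N :: int
proof -
  assume N: "0 < N"
  define q r where "q = x div N" and "r = x mod N"
  have x: "x = N * q + r" "0 \<le> r" "r < N" using N by (auto simp: q_def r_def)
  show ?thesis
  proof (cases "r + 1 = N")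
    case True
    then have "x + 1 = N * (q + 1)" using x by (simp add: algebra_simps)
    then show ?thesis unfolding q_def[symmetric] using N by simp
  next
    case False
    then have "(x + 1) div N = q \<and> (x + 1) mod N = r + 1"
      using x N by (auto intro!: int_div_pos_eq[of _ _ _ "r + 1"] int_mod_pos_eq[of _ _ q] simp: algebra_simps)
    then show ?thesis unfolding q_def[symmetric] using x by auto
  qed
qed

lemma div_sum_step:
  assumes "0 < n"
  shows "div_sum n \<kappa> (e + 1) = div_sum n \<kappa> e + int (card {j. j < n \<and> (\<kappa> j - (e + 1)) mod int n = 0})"
proof -
  have "(e + 1 - \<kappa> j) div int n = (e - \<kappa> j) div int n + (if (\<kappa> j - (e + 1)) mod int n = 0 then 1 else 0)" for j
  proof -
    have "int n dvd e - \<kappa> j + 1 \<longleftrightarrow> int n dvd \<kappa> j - (e + 1)"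
      by (metis (no_types, opaque_lifting) add_diff_eq diff_diff_eq2 diff_add_eq dvd_minus_iff minus_diff_eq)
    then show ?thesis using div_plus1[of "int n" "e - \<kappa> j"] assms
      by (simp add: algebra_simps mod_eq_0_iff_dvd)
  qed
  then have "div_sum n \<kappa> (e + 1) = div_sum n \<kappa> e + (\<Sum>j<n. if (\<kappa> j - (e + 1)) mod int n = 0 then 1 else 0)"
    unfolding div_sum_def by (simp add: sum.distrib)
  also have "(\<Sum>j<n. if (\<kappa> j - (e + 1)) mod int n = 0 then 1 else 0) =
      int (card {j. j < n \<and> (\<kappa> j - (e + 1)) mod int n = 0})"
    by (subst sum.If_cases) (auto intro!: arg_cong[where f=card])
  finally show ?thesis .
qed

lemma card_mod_split:
  assumes "0 \<le> k" "k < int n"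
  shows "card {j. j < n \<and> (\<kappa> j - c) mod int n = k} =
    card {j. j < n \<and> (\<kappa> j - c) mod (2 * int n) = k} +
    card {j. j < n \<and> (\<kappa> j - c) mod (2 * int n) = k + int n}"
proof -
  have "x mod int n = k \<longleftrightarrow> x mod (2 * int n) = k \<or> x mod (2 * int n) = k + int n" for x
  proof -
    define y where "y = x mod (2 * int n)"
    have y: "0 \<le> y" "y < 2 * int n" using assms by (auto simp: y_def)
    have "x mod int n = y mod int n" by (simp add: y_def mod_mod_cancel)
    also have "y mod int n = (if y < int n then y else y - int n)"
      using y by (auto simp: mod_pos_pos_trivial intro: int_mod_pos_eq[of _ _ 1])
    finally show ?thesis using y assms unfolding y_def[symmetric] by auto
  qed
  then have "{j. j < n \<and> (\<kappa> j - c) mod int n = k} =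
    {j. j < n \<and> (\<kappa> j - c) mod (2 * int n) = k} \<union>
    {j. j < n \<and> (\<kappa> j - c) mod (2 * int n) = k + int n}" by auto
  moreover have "{j. j < n \<and> (\<kappa> j - c) mod (2 * int n) = k} \<inter>
    {j. j < n \<and> (\<kappa> j - c) mod (2 * int n) = k + int n} = {}" using assms by auto
  ultimately show ?thesis by (simp add: card_Un_disjoint)
qed

text \<open>\<open>D\<close> is the total drift at an angle of the circle modulo \<open>pi\<close>, read off just after
  each of the \<open>n\<close> lines. The last clause excludes the words that meet every antipodal pair of
  regions exactly once.\<close>

definition balanced :: "nat \<Rightarrow> nat list \<Rightarrow> bool" where
  "balanced n w \<longleftrightarrow> (\<exists>D :: nat \<Rightarrow> int. (\<forall>k\<le>n. D k = 0 \<or> D k = 1) \<and> D n = D 0 \<and>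
     (\<forall>k<n. int (w ! k) + int (w ! (k + n)) = 1 + D (Suc k) - D k) \<and>
     (\<exists>k<n. D (Suc k) \<noteq> D k))"

section \<open>The height of a realizable word and why it is not constant\<close>

context generic_points
begin

text \<open>The angle \<open>t\<close> lies strictly between lines \<open>L t\<close> and
  \<open>L t + 1\<close>, so line \<open>e\<close> is past \<open>t + q * pi\<close> exactly when
  \<open>e\<close> is at least \<open>L t + 1 + q * n\<close>; hence the
  \<open>e - 1\<close>.\<close>

lemma floor_line_angle:
  assumes "\<not> is_line t"
  shows "\<lfloor>(line_angle e - t) / pi\<rfloor> = (e - 1 - L t) div int n"
proof -
  define q where "q = (e - 1 - L t) div int n"
  define r where "r = (e - 1 - L t) mod int n"
  have e: "e = L t + q * int n + 1 + r" "0 \<le> r" "r < int n"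
    using n_pos by (auto simp: q_def r_def)
  have t: "line_angle (L t) < t" "t < line_angle (L t + 1)"
    using sector_iff[of t "L t"] assms by auto
  have mono: "line_angle c \<le> line_angle d" if "c \<le> d" for c d
    using that line_angle_strict by (metis order_le_less)
  have "t + of_int q * pi < line_angle (L t + 1 + q * int n)"
    using t(2) line_angle_shift[of "L t + 1" q] by simp
  also have "\<dots> \<le> line_angle e" using e by (intro mono) auto
  finally have lo: "t + of_int q * pi < line_angle e" .
  have "line_angle e \<le> line_angle (L t + (q + 1) * int n)"
    using e by (intro mono) (auto simp: algebra_simps)
  also have "\<dots> < t + of_int (q + 1) * pi" using t(1) line_angle_shift[of "L t" "q + 1"] by simp
  finally have hi: "line_angle e < t + of_int (q + 1) * pi" .
  have "of_int q \<le> (line_angle e - t) / pi" using lo by (simp add: field_simps)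
  moreover have "(line_angle e - t) / pi < of_int q + 1" using hi by (simp add: field_simps)
  ultimately show ?thesis unfolding q_def[symmetric] by (intro floor_unique)
qed

lemma line_angle_obtain:
  obtains i q where "i < n" "line_angle c = mid \<theta> i + of_int q * pi"
proof -
  obtain i where i: "i < n" "sin (line_angle c - mid \<theta> i) = 0"
    using line_angle(1)[of c] by (auto simp: is_line_def)
  then obtain q :: int where "line_angle c - mid \<theta> i = of_int q * pi"
    using sin_zero_iff_int2 by blast
  then show ?thesis using that i by (simp add: algebra_simps)
qed

lemma drift_line:
  assumes "i < n" shows "drift (mid \<theta> i + 2 * pi * of_int q) = 0"
  using mid_between[OF assms] by (intro drift_eq_0[OF assms, of q]) auto

text \<open>This is the sum of the drifts at line \<open>e\<close> and at its antipode. One of these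
  two angles is a midpoint on the circle, according to the parity of \<open>q\<close>, and has drift
  0; so the sum is at most 1.\<close>

lemma div_sum_bounds:
  "div_sum n (\<lambda>j. L (\<theta> j)) (e - 1) - e \<in> {0, 1}"
proof -
  have "div_sum n (\<lambda>j. L (\<theta> j)) (e - 1) = floor_count n \<theta> (line_angle e)"
    unfolding div_sum_def floor_count_def[of n \<theta>]
    by (intro sum.cong refl floor_line_angle[symmetric] theta_not_line) auto
  moreover have "L (line_angle e) = e" by (rule line_angle)
  ultimately have "div_sum n (\<lambda>j. L (\<theta> j)) (e - 1) - e = drift (line_angle e) + drift (line_angle e + pi)"
    using floor_count_diff[of "line_angle e"] by simp
  moreover have "drift (line_angle e) = 0 \<or> drift (line_angle e + pi) = 0"
  proof -
    obtain i q where iq: "i < n" "line_angle e = mid \<theta> i + of_int q * pi" by (rule line_angle_obtain)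
    show ?thesis
    proof (cases "even q")
      case True
      then obtain p where "q = 2 * p" by blast
      then have "line_angle e = mid \<theta> i + 2 * pi * of_int p" using iq by simp
      then show ?thesis using drift_line iq by metis
    next
      case False
      then obtain p where "q = 2 * p + 1" by (rule oddE)
      then have "line_angle e + pi = mid \<theta> i + 2 * pi * of_int (p + 1)" using iq by (simp add: algebra_simps)
      then show ?thesis using drift_line iq by metis
    qed
  qed
  moreover have "drift (line_angle e) \<in> {0, 1}" "drift (line_angle e + pi) \<in> {0, 1}"
    using drift_bounds[of "line_angle e"] drift_bounds[of "line_angle e + pi"] by auto
  ultimately show ?thesis by auto
qed

text \<open>Otherwise each point lies in a sector of its own modulo \<open>pi\<close>, so the points sum to less
  than \<open>pi\<close> more than the line angles that precede them; but the midpoints sum to exactly \<open>pi\<close>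
  more than the points, and both sums agree modulo \<open>pi\<close>.\<close>

lemma theta_not_bijective: "\<not> bij_betw (\<lambda>i. (L (\<theta> i) - c) mod int n) {..<n} {0..<int n}"
proof
  assume bij: "bij_betw (\<lambda>i. (L (\<theta> i) - c) mod int n) {..<n} {0..<int n}"
  let ?h = "\<lambda>k. line_angle (c + k)"
  have cong: "line_angle e = ?h ((e - c) mod int n) + of_int ((e - c) div int n) * pi" for e
  proof -
    have "e = c + (e - c) mod int n + ((e - c) div int n) * int n" by (simp add: mod_div_mult_eq algebra_simps)
    then show ?thesis
      using line_angle_shift by metis
  qed
  have sum_cong: "\<exists>a::int. (\<Sum>i<n. line_angle (\<kappa> i)) = (\<Sum>k\<in>{0..<int n}. ?h k) + of_int a * pi"
    if b: "bij_betw (\<lambda>i. (\<kappa> i - c) mod int n) {..<n} {0..<int n}" for \<kappa>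
  proof -
    define a where "a i = (\<kappa> i - c) div int n" for i
    have "(\<Sum>i<n. line_angle (\<kappa> i)) = (\<Sum>i<n. ?h ((\<kappa> i - c) mod int n) + of_int (a i) * pi)"
      unfolding a_def by (intro sum.cong refl cong)
    also have "\<dots> = (\<Sum>i<n. ?h ((\<kappa> i - c) mod int n)) + of_int (\<Sum>i<n. a i) * pi"
      by (simp add: sum.distrib sum_distrib_right)
    also have "(\<Sum>i<n. ?h ((\<kappa> i - c) mod int n)) = (\<Sum>k\<in>{0..<int n}. ?h k)"
      by (rule sum.reindex_bij_betw[OF b])
    finally show ?thesis by blast
  qed
  obtain a where a: "(\<Sum>i<n. line_angle (L (\<theta> i))) = (\<Sum>k\<in>{0..<int n}. ?h k) + of_int a * pi"
    using sum_cong[OF bij] by blast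
  obtain b where b: "(\<Sum>i<n. line_angle (L (mid \<theta> i))) = (\<Sum>k\<in>{0..<int n}. ?h k) + of_int b * pi"
    using sum_cong[OF bij_L_m_mod] by blast
  have mid: "(\<Sum>i<n. line_angle (L (mid \<theta> i))) = (\<Sum>i<n. mid \<theta> i)"
    by (intro sum.cong refl line_angle_eqI is_line_m) auto
  have "(\<Sum>i<n. mid \<theta> i) = (\<Sum>i<n. \<theta> i) + pi"
  proof -
    have "2 * (\<Sum>i<n. mid \<theta> i) - 2 * (\<Sum>i<n. \<theta> i) = (\<Sum>i<n. \<theta> (Suc i) - \<theta> i)"
      unfolding sum_distrib_left sum_subtractf[symmetric]
      by (intro sum.cong refl) (simp add: mid_def field_simps)
    also have "\<dots> = \<theta> n - \<theta> 0" by (rule sum_lessThan_telescope)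
    finally show ?thesis using closed by simp
  qed
  then have \<theta>: "(\<Sum>i<n. \<theta> i) = (\<Sum>i<n. line_angle (L (\<theta> i))) + of_int (b - a - 1) * pi"
    using a b mid by (simp add: algebra_simps)
  have lt: "line_angle (L (\<theta> i)) < \<theta> i" "\<theta> i < line_angle (L (\<theta> i) + 1)" if "i < n" for i
    using sector_iff[of "\<theta> i" "L (\<theta> i)"] theta_not_line[OF that] by auto
  have lo: "(\<Sum>i<n. line_angle (L (\<theta> i))) < (\<Sum>i<n. \<theta> i)"
    using lt n_pos by (intro sum_strict_mono) auto
  have "(\<Sum>i<n. \<theta> i) < (\<Sum>i<n. line_angle (L (\<theta> i) + 1))"
    using lt n_pos by (intro sum_strict_mono) auto
  also have "\<dots> = (\<Sum>i<n. line_angle (L (\<theta> i))) + pi"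
  proof -
    \<comment> \<open>The width of a sector depends only on its index modulo \<open>n\<close>. Under
      \<open>bij\<close> the sectors of the points therefore have the widths of one full period,
      which telescope to \<open>pi\<close>.\<close>
    have gap: "line_angle (e + 1) - line_angle e = ?h ((e - c) mod int n + 1) - ?h ((e - c) mod int n)" for e
    proof -
      define q where "q = (e - c) div int n"
      have e: "e = c + (e - c) mod int n + q * int n" by (simp add: q_def mod_div_mult_eq algebra_simps)
      then have e1: "e + 1 = c + ((e - c) mod int n + 1) + q * int n" by simp
      have "line_angle e = ?h ((e - c) mod int n) + of_int q * pi" using e line_angle_shift by metis
      moreover have "line_angle (e + 1) = ?h ((e - c) mod int n + 1) + of_int q * pi"
        using e1 line_angle_shift by metis
      ultimately show ?thesis by simp
    qed
    have "(\<Sum>i<n. line_angle (L (\<theta> i) + 1)) - (\<Sum>i<n. line_angle (L (\<theta> i)))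
        = (\<Sum>i<n. ?h ((L (\<theta> i) - c) mod int n + 1) - ?h ((L (\<theta> i) - c) mod int n))"
      unfolding sum_subtractf[symmetric] by (intro sum.cong refl gap)
    also have "\<dots> = (\<Sum>k\<in>{0..<int n}. ?h (k + 1) - ?h k)"
      by (rule sum.reindex_bij_betw[OF bij])
    also have "\<dots> = (\<Sum>k<n. ?h (int (Suc k)) - ?h (int k))"
    proof (rule sum.reindex_bij_witness[of _ int nat])
    qed (auto simp: algebra_simps)
    also have "\<dots> = ?h (int n) - ?h 0" using sum_lessThan_telescope[of "\<lambda>k. ?h (int k)" n] by simp
    also have "\<dots> = pi" using line_angle_shift[of c 1] by simp
    finally show ?thesis by simp
  qed
  finally have "of_int (b - a - 1) * pi < 1 * pi" using \<theta> by simp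
  moreover have "0 * pi < of_int (b - a - 1) * pi" using \<theta> lo by simp
  ultimately have "0 < b - a - 1" "b - a - 1 < 1" using pi_gt_zero
    by (simp_all only: mult_less_cancel_right_pos of_int_0_less_iff of_int_less_1_iff)
  then show False by simp
qed

lemma occupancy_balanced:
  assumes P: "\<forall>i<n. P i = cis (\<theta> i)" and R: "region_numbering n P R"
  shows "balanced n (occupancy n P R)"
proof -
  define w where "w = occupancy n P R"
  have w: "w ! k = card {j. j < n \<and> (L (\<theta> j) - L 0) mod (2 * int n) = int k}" if "k < 2 * n" for k
    unfolding w_def occupancy_eq[OF P R] using that by simp
  \<comment> \<open>The excess of points over lines taken at line \<open>L 0 + k\<close>, where
    region \<open>k\<close> begins, in the normalisation of \<open>div_sum_bounds\<close>.\<close>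
  define D where "D k = div_sum n (\<lambda>j. L (\<theta> j)) (L 0 + int k - 1) - (L 0 + int k)" for k
  have pair: "w ! k + w ! (k + n) = card {j. j < n \<and> (L (\<theta> j) - L 0) mod int n = int k}" if "k < n" for k
    using card_mod_split[of "int k" n "\<lambda>j. L (\<theta> j)" "L 0"] that by (simp add: w)
  have step: "int (w ! k) + int (w ! (k + n)) = 1 + D (Suc k) - D k" if "k < n" for k
  proof -
    have *: "(x - L 0) mod int n = int k \<longleftrightarrow> (x - (L 0 + int k)) mod int n = 0" for x
    proof -
      have "(x - L 0) mod int n = int k mod int n \<longleftrightarrow> (x - (L 0 + int k)) mod int n = 0"
        by (simp add: mod_eq_dvd_iff mod_eq_0_iff_dvd algebra_simps)
      then show ?thesis using that by simp
    qed
    show ?thesis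
      using div_sum_step[of n "\<lambda>j. L (\<theta> j)" "L 0 + int k - 1"] pair[OF that] n_pos
      unfolding D_def by (simp add: * algebra_simps)
  qed
  have "D n = D 0"
  proof -
    have "(L 0 + int n - 1 - x) div int n = (L 0 - 1 - x) div int n + 1" for x
    proof -
      have "L 0 + int n - 1 - x = (L 0 - 1 - x) + int n" by simp
      then show ?thesis using n_pos by (metis div_add_self2 of_nat_0_less_iff less_irrefl)
    qed
    then show ?thesis by (simp add: D_def div_sum_def sum.distrib)
  qed
  moreover have "D k = 0 \<or> D k = 1" for k
    using div_sum_bounds[of "L 0 + int k"] by (simp add: D_def)
  moreover have "\<exists>k<n. D (Suc k) \<noteq> D k"
  proof (rule ccontr)
    assume "\<not> (\<exists>k<n. D (Suc k) \<noteq> D k)"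
    \<comment> \<open>With \<open>D\<close> constant every residue modulo \<open>n\<close> is met by
      exactly one point, the situation ruled out by \<open>theta_not_bijective\<close>.\<close>
    then have one: "card {j. j < n \<and> (L (\<theta> j) - L 0) mod int n = int k} = 1" if "k < n" for k
      using step[OF that] pair[OF that] that by simp
    have "(\<lambda>i. (L (\<theta> i) - L 0) mod int n) ` {..<n} = {0..<int n}"
    proof (intro set_eqI iffI)
      fix x assume "x \<in> {0..<int n}"
      then have "card {j. j < n \<and> (L (\<theta> j) - L 0) mod int n = x} = 1" using one[of "nat x"] by (simp add: nat_less_iff)
      then have "{j. j < n \<and> (L (\<theta> j) - L 0) mod int n = x} \<noteq> {}" by (metis card.empty zero_neq_one)
      then show "x \<in> (\<lambda>i. (L (\<theta> i) - L 0) mod int n) ` {..<n}" by auto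
    qed (use n_pos in auto)
    moreover from this have "inj_on (\<lambda>i. (L (\<theta> i) - L 0) mod int n) {..<n}"
      by (intro eq_card_imp_inj_on) auto
    ultimately show False using theta_not_bijective[of "L 0"] by (simp add: bij_betw_def)
  qed
  ultimately show ?thesis unfolding balanced_def w_def[symmetric] using step by blast
qed

end

section \<open>Realizing balanced words\<close>

text \<open>Region numbers need to be known only up to a common constant \<open>c\<close>: turning
  the circle by the middle angle \<open>\<rho>\<close> of sector \<open>c\<close> brings the point 1
  into that sector.\<close>

lemma (in generic_points) realizableI:
  assumes L: "\<forall>j<n. L (\<theta> j) = \<kappa> j + c"
    and w: "w \<in> binary_words (2 * n)"
      "\<forall>k<2 * n. w ! k = card {j. j < n \<and> \<kappa> j mod (2 * int n) = int k}"
  shows "w \<in> realizable_words n"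
proof -
  define \<rho> where "\<rho> = (line_angle c + line_angle (c + 1)) / 2"
  have "\<rho> \<in> {line_angle c<..<line_angle (c + 1)}"
    using line_angle_strict[of c "c + 1"] by (simp add: \<rho>_def)
  then have \<rho>: "\<not> is_line \<rho>" "L \<rho> = c" using sector_iff by blast+
  define \<theta>' where "\<theta>' i = \<theta> i - \<rho>" for i
  have mid': "mid \<theta>' i = mid \<theta> i - \<rho>" for i by (simp add: mid_def \<theta>'_def field_simps)
  have L': "floor_count n (mid \<theta>') t = L (t + \<rho>)" for t by (simp add: floor_count_def mid' algebra_simps)
  interpret S: line_system n "mid \<theta>'"
    by unfold_locales (use n_pos distinct in \<open>auto simp: mid'\<close>)
  have line': "S.is_line t \<longleftrightarrow> is_line (t + \<rho>)" for t
    by (simp add: S.is_line_def is_line_def mid' algebra_simps)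
  interpret S: generic_points n \<theta>'
    by unfold_locales
      (use n_ge mono_Suc closed theta_not_line in \<open>auto simp: \<theta>'_def line'\<close>)
  let ?P = "\<lambda>i. cis (\<theta>' i)" and ?R = "\<lambda>k. S.sector (floor_count n (mid \<theta>') 0 + int k)"
  have P: "\<forall>i<n. ?P i = cis (\<theta>' i)" by simp
  have nl: "\<not> S.is_line 0" using \<rho> by (simp add: line')
  have "w = occupancy n ?P ?R"
  proof (rule nth_equalityI)
    show "length w = length (occupancy n ?P ?R)"
      using w(1) by (simp add: binary_words_def occupancy_def)
    fix k assume "k < length w"
    then have k: "k < 2 * n" using w(1) by (simp add: binary_words_def)
    have "{j. j < n \<and> (floor_count n (mid \<theta>') (\<theta>' j) - floor_count n (mid \<theta>') 0) mod (2 * int n) = int k} =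
        {j. j < n \<and> \<kappa> j mod (2 * int n) = int k}"
      using L \<rho> by (auto simp: L' \<theta>'_def)
    then show "w ! k = occupancy n ?P ?R ! k"
      using S.occupancy_eq[OF P S.region_numbering_sectors[OF P nl]] w(2) k by simp
  qed
  then show ?thesis unfolding realizable_words_def
    using w(1) S.genericI[OF P nl] S.region_numbering_sectors[OF P nl] by blast
qed

section \<open>Small perturbations that separate the lines\<close>

lemma eventually_floor_pi:
  fixes x b :: real
  assumes "sin x \<noteq> 0"
  shows "\<forall>\<^sub>F \<epsilon> in at_right 0. \<lfloor>(x + \<epsilon> * b) / pi\<rfloor> = \<lfloor>x / pi\<rfloor> \<and> sin (x + \<epsilon> * b) \<noteq> 0"
proof -
  define q where "q = \<lfloor>x / pi\<rfloor>"
  have "x \<noteq> of_int q * pi" using assms sin_eq_0_iff_floor[of x] by (simp add: q_def)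
  moreover have "of_int q \<le> x / pi" "x / pi < of_int q + 1" unfolding q_def by linarith+
  ultimately have x: "of_int q * pi < x" "x < (of_int q + 1) * pi"
    by (auto simp: pos_le_divide_eq pos_divide_less_eq)
  have lim: "((\<lambda>\<epsilon>. x + \<epsilon> * b) \<longlongrightarrow> x) (at_right 0)" by (auto intro!: tendsto_eq_intros)
  have "\<forall>\<^sub>F \<epsilon> in at_right 0. of_int q * pi < x + \<epsilon> * b" "\<forall>\<^sub>F \<epsilon> in at_right 0. x + \<epsilon> * b < (of_int q + 1) * pi"
    using order_tendstoD[OF lim] x by auto
  then show ?thesis
  proof eventually_elim
    case (elim \<epsilon>)
    then have "\<lfloor>(x + \<epsilon> * b) / pi\<rfloor> = q"
      by (intro floor_unique) (auto simp: pos_le_divide_eq pos_divide_less_eq)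
    then show ?case using sin_eq_0_iff_floor[of "x + \<epsilon> * b"] elim by (auto simp: q_def)
  qed
qed

lemma eventually_sin_nonzero:
  fixes x b :: real
  assumes "b \<noteq> 0"
  shows "\<forall>\<^sub>F \<epsilon> in at_right 0. sin (x + \<epsilon> * b) \<noteq> 0"
proof (cases "sin x = 0")
  case False
  from eventually_floor_pi[OF this, of b] show ?thesis by eventually_elim simp
next
  case True
  then obtain a :: int where a: "x = of_int a * pi" using sin_zero_iff_int2 by blast
  have lim: "((\<lambda>\<epsilon>. \<bar>\<epsilon> * b\<bar>) \<longlongrightarrow> 0) (at_right 0)" by (auto intro!: tendsto_eq_intros)
  have "\<forall>\<^sub>F \<epsilon> in at_right 0. \<bar>\<epsilon> * b\<bar> < pi" using order_tendstoD(2)[OF lim, of pi] by simp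
  moreover have "\<forall>\<^sub>F \<epsilon> in at_right (0::real). \<epsilon> > 0" by (rule eventually_at_right_less)
  ultimately show ?thesis
  proof eventually_elim
    case (elim \<epsilon>)
    show ?case
    proof
      assume "sin (x + \<epsilon> * b) = 0"
      then have "sin (\<epsilon> * b) = 0" using sin_shift_eq_0_iff[of "\<epsilon> * b" a] a by (simp add: add.commute)
      then obtain k :: int where k: "\<epsilon> * b = of_int k * pi" using sin_zero_iff_int2 by blast
      then have "\<bar>of_int k\<bar> * pi < 1 * pi" using elim by (simp add: abs_mult)
      then have "k = 0" by (simp only: mult_less_cancel_right_pos pi_gt_zero)
      then show False using k elim assms by simp
    qed
  qed
qed

text \<open>A direction in which no two midpoints move at the same speed.\<close>

definition pert :: "nat \<Rightarrow> nat \<Rightarrow> real" where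
  "pert n i = (if i < n then 2 ^ i else 1)"

text \<open>The speeds are \<open>3 * 2 ^ i / 2\<close>, except the last one,
  \<open>(2 ^ j + 1) / 2\<close>, since the closing point must move with the first. Parity tells the
  last from the others when \<open>i > 0\<close>; for \<open>i = 0\<close> it is size, as
  \<open>n \<ge> 3\<close> gives \<open>j \<ge> 2\<close>.\<close>

lemma mid_pert_neq:
  assumes "3 \<le> n" "i < j" "j < n"
  shows "mid (pert n) i \<noteq> mid (pert n) j"
proof (cases "Suc j < n")
  case True
  then have mids: "mid (pert n) i = 3 * 2 ^ i / 2" "mid (pert n) j = 3 * 2 ^ j / 2"
    using assms by (auto simp: mid_def pert_def)
  show ?thesis unfolding mids using assms by simp
next
  case False
  then have j: "n = Suc j" using assms by simp
  have "3 * 2 ^ i \<noteq> (2 ^ j + 1 :: nat)"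
  proof (cases i)
    case 0
    have "(2::nat) ^ 2 \<le> 2 ^ j" using assms j by (intro power_increasing) auto
    then show ?thesis using 0 by simp
  next
    case (Suc i')
    have "even (3 * 2 ^ i :: nat)" "odd (2 ^ j + 1 :: nat)" using Suc assms by auto
    then show ?thesis by metis
  qed
  then have "real (3 * 2 ^ i) \<noteq> real (2 ^ j + 1)" by (metis of_nat_eq_iff)
  then show ?thesis using assms j by (simp add: mid_def pert_def)
qed

text \<open>The order of the points, their being off the lines and the counts are open conditions
  and survive a small motion along \<open>pert\<close>. Distinctness of the lines is gained because
  the midpoints move at different speeds.\<close>

lemma (in circle_points) perturb:
  assumes n3: "3 \<le> n" and off: "\<forall>i<n. \<forall>j<n. sin (\<theta> j - mid \<theta> i) \<noteq> 0"
  obtains \<theta>' where "generic_points n \<theta>'"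
    "\<forall>j<n. floor_count n (mid \<theta>') (\<theta>' j) = floor_count n (mid \<theta>) (\<theta> j)"
proof -
  define \<theta>' where "\<theta>' \<epsilon> i = \<theta> i + \<epsilon> * pert n i" for \<epsilon> i
  have mid': "mid (\<theta>' \<epsilon>) i = mid \<theta> i + \<epsilon> * mid (pert n) i" for \<epsilon> i
    by (simp add: mid_def \<theta>'_def field_simps)
  have ev1: "\<forall>\<^sub>F \<epsilon> in at_right 0. \<forall>i\<in>{..<n}. \<theta>' \<epsilon> i < \<theta>' \<epsilon> (Suc i)"
  proof (intro eventually_ball_finite ballI)
    fix i assume i: "i \<in> {..<n}"
    have lim: "((\<lambda>\<epsilon>. \<theta>' \<epsilon> (Suc i) - \<theta>' \<epsilon> i) \<longlongrightarrow> \<theta> (Suc i) - \<theta> i) (at_right 0)"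
      unfolding \<theta>'_def by (auto intro!: tendsto_eq_intros)
    show "\<forall>\<^sub>F \<epsilon> in at_right 0. \<theta>' \<epsilon> i < \<theta>' \<epsilon> (Suc i)"
      using order_tendstoD(1)[OF lim, of 0] mono_Suc[of i] i by simp
  qed simp
  have ev2: "\<forall>\<^sub>F \<epsilon> in at_right 0. \<forall>j\<in>{..<n}. \<forall>i\<in>{..<n}.
      \<lfloor>(\<theta>' \<epsilon> j - mid (\<theta>' \<epsilon>) i) / pi\<rfloor> = \<lfloor>(\<theta> j - mid \<theta> i) / pi\<rfloor> \<and> sin (\<theta>' \<epsilon> j - mid (\<theta>' \<epsilon>) i) \<noteq> 0"
  proof (intro eventually_ball_finite ballI)
    fix j i assume "j \<in> {..<n}" "i \<in> {..<n}"
    then have "sin (\<theta> j - mid \<theta> i) \<noteq> 0" using off by blast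
    from eventually_floor_pi[OF this, of "pert n j - mid (pert n) i"]
    show "\<forall>\<^sub>F \<epsilon> in at_right 0. \<lfloor>(\<theta>' \<epsilon> j - mid (\<theta>' \<epsilon>) i) / pi\<rfloor> = \<lfloor>(\<theta> j - mid \<theta> i) / pi\<rfloor>
        \<and> sin (\<theta>' \<epsilon> j - mid (\<theta>' \<epsilon>) i) \<noteq> 0"
      unfolding mid' \<theta>'_def by (simp add: algebra_simps)
  qed auto
  have ev3: "\<forall>\<^sub>F \<epsilon> in at_right 0. \<forall>i\<in>{..<n}. \<forall>j\<in>{..<n} - {i}. sin (mid (\<theta>' \<epsilon>) i - mid (\<theta>' \<epsilon>) j) \<noteq> 0"
  proof (intro eventually_ball_finite ballI)
    fix i j assume ij: "i \<in> {..<n}" "j \<in> {..<n} - {i}"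
    then have "mid (pert n) i - mid (pert n) j \<noteq> 0"
      using mid_pert_neq[OF n3, of i j] mid_pert_neq[OF n3, of j i] by (cases "i < j") auto
    from eventually_sin_nonzero[OF this, of "mid \<theta> i - mid \<theta> j"]
    show "\<forall>\<^sub>F \<epsilon> in at_right 0. sin (mid (\<theta>' \<epsilon>) i - mid (\<theta>' \<epsilon>) j) \<noteq> 0"
      unfolding mid' by (simp add: algebra_simps)
  qed auto
  from eventually_happens'[OF _ eventually_conj[OF ev1 eventually_conj[OF ev2 ev3]]]
  obtain \<epsilon> where \<epsilon>: "\<forall>i\<in>{..<n}. \<theta>' \<epsilon> i < \<theta>' \<epsilon> (Suc i)"
    "\<forall>j\<in>{..<n}. \<forall>i\<in>{..<n}.
      \<lfloor>(\<theta>' \<epsilon> j - mid (\<theta>' \<epsilon>) i) / pi\<rfloor> = \<lfloor>(\<theta> j - mid \<theta> i) / pi\<rfloor> \<and> sin (\<theta>' \<epsilon> j - mid (\<theta>' \<epsilon>) i) \<noteq> 0"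
    "\<forall>i\<in>{..<n}. \<forall>j\<in>{..<n} - {i}. sin (mid (\<theta>' \<epsilon>) i - mid (\<theta>' \<epsilon>) j) \<noteq> 0"
    by auto
  interpret S: line_system n "mid (\<theta>' \<epsilon>)"
    by unfold_locales (use n3 \<epsilon>(3) in auto)
  have "generic_points n (\<theta>' \<epsilon>)"
    by unfold_locales
      (use n3 \<epsilon>(1,2) closed in \<open>auto simp: S.is_line_def \<theta>'_def pert_def\<close>)
  moreover have "\<forall>j<n. floor_count n (mid (\<theta>' \<epsilon>)) (\<theta>' \<epsilon> j) = floor_count n (mid \<theta>) (\<theta> j)"
    unfolding floor_count_def using \<epsilon>(2) by (auto intro!: sum.cong)
  ultimately show ?thesis using that by blast
qed

section \<open>Periodic sequences and slots with geometric gaps\<close>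

lemma int_constant:
  fixes f :: "int \<Rightarrow> 'a"
  assumes "\<And>k. f (k + 1) = f k"
  shows "f k = f 0"
proof (induction k rule: int_induct[where k=0])
  case (step2 i)
  then show ?case using assms[of "i - 1"] by simp
qed (simp_all add: assms)

locale balanced_sequence =
  fixes n :: nat and W :: "int \<Rightarrow> nat" and D :: "int \<Rightarrow> int" and r :: int
  assumes n3: "3 \<le> n"
    and W_period: "W (k + 2 * int n) = W k" and W01: "W k = 0 \<or> W k = 1"
    and D_period: "D (k + int n) = D k" and D01: "D k = 0 \<or> D k = 1"
    and pair: "int (W k) + int (W (k + int n)) = 1 + D (k + 1) - D k"
    and nonconst: "D (r + 1) \<noteq> D r"
begin

lemma W_shift: "W (k + 2 * int n * q) = W k"
  using int_constant[of "\<lambda>q. W (k + 2 * int n * q)" q] W_period[of "k + 2 * int n * x" for x]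
  by (simp add: algebra_simps)

lemma D_shift: "D (k + int n * q) = D k"
  using int_constant[of "\<lambda>q. D (k + int n * q)" q] D_period[of "k + int n * x" for x]
  by (simp add: algebra_simps)

text \<open>Gaps halve where \<open>D\<close> stays \<open>0\<close> and double where it stays \<open>1\<close>; the only discontinuity of
  the exponents, at \<open>r\<close>, sits at a jump of \<open>D\<close>, where no condition is needed.\<close>

definition height :: "int \<Rightarrow> nat" where
  "height k = nat ((k - r) mod int n)"

text \<open>The height after slot \<open>k\<close> decides: in the intended picture line
  \<open>k + 1\<close> separates slots \<open>k\<close> and \<open>k + 1\<close>, and the height
  read there is \<open>D (k + 1)\<close>.\<close>

definition weight :: "int \<Rightarrow> real" where
  "weight k = (if D (k + 1) = 1 then 2 ^ height k else (1 / 2) ^ height k)"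

definition gap :: "int \<Rightarrow> real" where
  "gap k = weight k * pi / (\<Sum>j\<in>{0..<int n}. weight j)"

text \<open>Partial sums of \<open>gap\<close> extended to negative \<open>k\<close>; at least one
  of the two sums is empty.\<close>

definition pos :: "int \<Rightarrow> real" where
  "pos k = (\<Sum>j\<in>{0..<k}. gap j) - (\<Sum>j\<in>{k..<0}. gap j)"

lemma weight_pos: "0 < weight k"
  by (simp add: weight_def)

lemma total_pos: "0 < (\<Sum>j\<in>{0..<int n}. weight j)"
  using n3 weight_pos by (intro sum_pos) auto

lemma gap_pos: "0 < gap k"
  unfolding gap_def using weight_pos total_pos by (intro divide_pos_pos mult_pos_pos) auto

lemma gap_period: "gap (k + int n) = gap k"
proof -
  have "(k + int n - r) mod int n = (k - r) mod int n"
    by (metis add_diff_eq diff_add_eq mod_add_self2)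
  moreover have "D (k + int n + 1) = D (k + 1)" using D_period[of "k + 1"] by (simp add: algebra_simps)
  ultimately show ?thesis by (simp add: gap_def weight_def height_def)
qed

lemma gap_total: "(\<Sum>j\<in>{0..<int n}. gap j) = pi"
  unfolding gap_def using total_pos by (simp add: sum_divide_distrib[symmetric] sum_distrib_right[symmetric])

lemma pos_step: "pos (k + 1) = pos k + gap k"
proof (cases "0 \<le> k")
  case True
  then have "{0..<k + 1} = insert k {0..<k}" by auto
  then show ?thesis using True by (simp add: pos_def)
next
  case False
  then have "{k..<0} = insert k {k + 1..<0}" by auto
  then show ?thesis using False by (simp add: pos_def)
qed

lemma pos_less: "k < l \<Longrightarrow> pos k < pos l"
proof (induction l rule: int_gr_induct)
  case (step l)
  then show ?case using pos_step[of l] gap_pos[of l] by simp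
qed (use pos_step gap_pos in simp)

lemma pos_less_iff: "pos k < pos l \<longleftrightarrow> k < l"
  using pos_less by (metis less_asym linorder_neqE)

lemma pos_le_iff: "pos k \<le> pos l \<longleftrightarrow> k \<le> l"
  using pos_less_iff by (metis not_less)

lemma pos_period: "pos (k + int n) = pos k + pi"
proof -
  have "pos (k + int n) - pos k = pos (0 + int n) - pos 0"
  proof (rule int_constant)
    fix k
    show "pos (k + 1 + int n) - pos (k + 1) = pos (k + int n) - pos k"
      using pos_step[of k] pos_step[of "k + int n"] gap_period[of k] by (simp add: algebra_simps)
  qed
  also have "\<dots> = pi" using gap_total by (simp add: pos_def)
  finally show ?thesis by simp
qed

lemma pos_shift: "pos (k + q * int n) = pos k + of_int q * pi"
proof -
  have "pos (k + q * int n) - of_int q * pi = pos (k + 0 * int n) - of_int 0 * pi"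
  proof (rule int_constant)
    fix q show "pos (k + (q + 1) * int n) - of_int (q + 1) * pi = pos (k + q * int n) - of_int q * pi"
      using pos_period[of "k + q * int n"] by (simp add: algebra_simps)
  qed
  then show ?thesis by simp
qed

text \<open>The exponent restarts only where \<open>k\<close> is congruent to \<open>r\<close>
  modulo \<open>n\<close>, and there \<open>D\<close> jumps by \<open>nonconst\<close>.\<close>

lemma height_Suc: "D (k + 1) = D k \<Longrightarrow> height k = Suc (height (k - 1))"
proof -
  assume eq: "D (k + 1) = D k"
  define x where "x = (k - r) mod int n"
  have "x \<noteq> 0" unfolding x_def
  proof
    assume "(k - r) mod int n = 0"
    then obtain q where "k = r + int n * q" by (auto simp: mod_eq_0_iff_dvd dvd_def algebra_simps)
    then show False using eq nonconst D_shift[of r q] D_shift[of "r + 1" q] by (simp add: algebra_simps)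
  qed
  moreover have x: "0 \<le> x" "x < int n" using n3 by (auto simp: x_def)
  moreover have "k - r = int n * ((k - r) div int n) + x" by (simp add: x_def)
  ultimately have "(k - 1 - r) mod int n = x - 1"
    by (intro int_mod_pos_eq[of _ _ "(k - r) div int n"]) auto
  then show ?thesis
    using \<open>x \<noteq> 0\<close> x(1) by (simp add: height_def x_def[symmetric])
qed

lemma gap_halves: "D k = 0 \<Longrightarrow> D (k + 1) = 0 \<Longrightarrow> gap (k - 1) = 2 * gap k"
  using height_Suc[of k] by (simp add: gap_def weight_def)

lemma gap_doubles: "D k = 1 \<Longrightarrow> D (k + 1) = 1 \<Longrightarrow> gap k = 2 * gap (k - 1)"
  using height_Suc[of k] by (simp add: gap_def weight_def)

text \<open>Halving means that each gap equals its predecessor minus itself, so the sum telescopes.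
  The lemma \<open>pos_diff_expanding\<close> is the same argument read in the opposite
  direction.\<close>

lemma pos_diff_contracting:
  assumes "k \<le> l" "\<And>j. k \<le> j \<Longrightarrow> j \<le> l \<Longrightarrow> D j = 0"
  shows "pos l - pos k \<le> gap (k - 1) - gap (l - 1)"
  using assms
proof (induction l rule: int_ge_induct)
  case (step l)
  then have "pos l - pos k \<le> gap (k - 1) - gap (l - 1)" "D l = 0" "D (l + 1) = 0" by auto
  then show ?case using gap_halves[of l] pos_step[of l] by simp
qed simp

lemma pos_diff_expanding:
  assumes "i \<le> k" "\<And>j. i + 1 \<le> j \<Longrightarrow> j \<le> k + 1 \<Longrightarrow> D j = 1"
  shows "pos k - pos i \<le> gap k - gap i"
  using assms
proof (induction k rule: int_ge_induct)
  case (step k)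
  then have "pos k - pos i \<le> gap k - gap i" "D (k + 1) = 1" "D (k + 1 + 1) = 1" by auto
  then show ?case using gap_doubles[of "k + 1"] pos_step[of k] by simp
qed simp

text \<open>The line bisecting two consecutive points \<open>i\<close> and \<open>l\<close> passes an antipode \<open>k\<close> on the
  side prescribed by \<open>D\<close>.\<close>

lemma antipode_vs_midpoint:
  assumes W: "W k = 0" "W (k + int n) = 1" and ikl: "i < k" "k < l"
    and none: "\<And>j. i < j \<Longrightarrow> j < l \<Longrightarrow> W j = 0"
  shows "D k = 0 \<Longrightarrow> pos i + pos l < 2 * pos k" "D k = 1 \<Longrightarrow> 2 * pos k < pos i + pos l"
proof -
  \<comment> \<open>A rise of \<open>D\<close> needs both antipodal slots occupied, so
    \<open>D\<close> cannot rise strictly between consecutive points. Hence the value 0 at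
    \<open>k\<close> persists forward to \<open>l\<close>, and the value 1 persists backward to
    \<open>i + 1\<close>.\<close>
  have up: "W j = 1" if "D j = 0" "D (j + 1) = 1" for j
    using pair[of j] that W01[of j] W01[of "j + int n"] by auto
  {
    assume D0: "D k = 0"
    have D: "D j = 0" if "k \<le> j" "j \<le> l" for j
      using that
    proof (induction j rule: int_ge_induct)
      case (step j)
      then show ?case using up[of j] none[of j] D01[of "j + 1"] ikl by auto
    qed (rule D0)
    have "pos l - pos k < gap (k - 1)"
      using pos_diff_contracting[OF less_imp_le[OF ikl(2)] D] gap_pos[of "l - 1"] by simp
    also have "\<dots> = pos k - pos (k - 1)" using pos_step[of "k - 1"] by simp
    also have "\<dots> \<le> pos k - pos i" using ikl pos_le_iff[of i "k - 1"] by simp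
    finally show "pos i + pos l < 2 * pos k" by simp
  next
    assume D1: "D k = 1"
    have D1': "D (k + 1) = 1" using pair[of k] W D1 by simp
    have D: "D j = 1" if "j \<le> k + 1" "i + 1 \<le> j" for j
      using that
    proof (induction j rule: int_le_induct)
      case (step j)
      then show ?case using up[of "j - 1"] none[of "j - 1"] D01[of "j - 1"] ikl by auto
    qed (rule D1')
    have "pos k - pos i < gap k"
      using pos_diff_expanding[OF less_imp_le[OF ikl(1)] D] gap_pos[of i] by simp
    also have "\<dots> = pos (k + 1) - pos k" using pos_step[of k] by simp
    also have "\<dots> \<le> pos l - pos k" using ikl pos_le_iff[of "k + 1" l] by simp
    finally show "2 * pos k < pos i + pos l" by simp
  }
qed

section \<open>Occupied slots as indices of the points\<close>

definition ones :: "int set" where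
  "ones = {k \<in> {0..<2 * int n}. W k = 1}"

text \<open>Summing \<open>pair\<close> over one period, the contributions of \<open>D\<close>
  telescope to 0.\<close>

lemma card_ones: "card ones = n"
proof -
  have "card ones = (\<Sum>k\<in>{0..<2 * int n}. W k)"
  proof -
    have "(\<Sum>k\<in>{0..<2 * int n}. W k) = (\<Sum>k\<in>{0..<2 * int n}. if W k = 1 then 1 else 0)"
      using W01 by (intro sum.cong refl) auto
    also have "\<dots> = card ({0..<2 * int n} \<inter> {k. W k = 1})" by (subst sum.If_cases) auto
    finally show ?thesis by (simp add: ones_def Int_def)
  qed
  also have "\<dots> = (\<Sum>k\<in>{0..<int n}. W k) + (\<Sum>k\<in>{int n..<2 * int n}. W k)"
    by (subst sum.union_disjoint[symmetric]) (auto intro: sum.cong)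
  also have "(\<Sum>k\<in>{int n..<2 * int n}. W k) = (\<Sum>k\<in>{0..<int n}. W (k + int n))"
    by (rule sum.reindex_bij_witness[of _ "\<lambda>k. k + int n" "\<lambda>k. k - int n"]) auto
  finally have "int (card ones) = (\<Sum>k\<in>{0..<int n}. int (W k) + int (W (k + int n)))"
    by (simp add: sum.distrib)
  also have "\<dots> = (\<Sum>k\<in>{0..<int n}. 1 + (D (k + 1) - D k))"
    by (simp only: pair add_diff_eq)
  also have "\<dots> = int n + (\<Sum>k\<in>{0..<int n}. D (k + 1) - D k)" by (simp only: sum.distrib) simp
  also have "(\<Sum>k\<in>{0..<int n}. D (k + 1) - D k) = (\<Sum>k<n. D (int (Suc k)) - D (int k))"
    by (rule sum.reindex_bij_witness[of _ int nat]) (auto simp: algebra_simps)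
  also have "\<dots> = D (int n) - D 0" using sum_lessThan_telescope[of "\<lambda>k. D (int k)" n] by simp
  also have "\<dots> = 0" using D_period[of 0] by simp
  finally show ?thesis by simp
qed

text \<open>The value at \<open>n\<close> is the first occupied slot one turn later, so that
  \<open>pos\<close> closes the circle.\<close>

definition \<kappa> :: "nat \<Rightarrow> int" where
  "\<kappa> i = (if i < n then sorted_list_of_set ones ! i else sorted_list_of_set ones ! 0 + 2 * int n)"

lemma finite_ones: "finite ones"
  by (rule finite_subset[of _ "{0..<2 * int n}"]) (auto simp: ones_def)

lemma kappa_image: "\<kappa> ` {..<n} = ones"
proof -
  have "\<kappa> ` {..<n} = (!) (sorted_list_of_set ones) ` {..<length (sorted_list_of_set ones)}"
    using card_ones by (intro image_cong) (auto simp: \<kappa>_def)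
  also have "\<dots> = set (sorted_list_of_set ones)" by (auto simp: set_conv_nth)
  finally show ?thesis using finite_ones by simp
qed

lemma kappa_in: "i < n \<Longrightarrow> \<kappa> i \<in> ones"
  using kappa_image by blast

lemma kappa_less: "i < j \<Longrightarrow> j \<le> n \<Longrightarrow> \<kappa> i < \<kappa> j"
proof (cases "j = n")
  case True
  assume "i < j"
  then show ?thesis using kappa_in[of i] kappa_in[of 0] True by (auto simp: \<kappa>_def ones_def)
next
  case False
  assume "i < j" "j \<le> n"
  moreover have "sorted_wrt (<) (sorted_list_of_set ones)" by simp
  ultimately show ?thesis using False card_ones by (simp add: \<kappa>_def sorted_wrt_nth_less)
qed

lemma kappa_n: "\<kappa> n = \<kappa> 0 + 2 * int n"
  using n3 by (simp add: \<kappa>_def)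

lemma W_kappa: "i \<le> n \<Longrightarrow> W (\<kappa> i) = 1"
  using kappa_in[of i] kappa_in[of 0] kappa_n W_period[of "\<kappa> 0"] n3
  by (cases "i = n") (auto simp: ones_def)

lemma kappa_consecutive:
  assumes "i < n" "\<kappa> i < j" "j < \<kappa> (Suc i)"
  shows "W j = 0"
proof (rule ccontr)
  assume "W j \<noteq> 0"
  then have Wj: "W j = 1" using W01 by metis
  have j0: "0 \<le> j" using kappa_in[OF assms(1)] assms(2) by (auto simp: ones_def)
  show False
  proof (cases "j < 2 * int n")
    case True
    then have "j \<in> ones" using Wj j0 by (simp add: ones_def)
    then obtain i' where i': "i' < n" "j = \<kappa> i'" using kappa_image by blast
    have "i < i'" using assms i' kappa_less[of i' i] by (metis le_less_linear less_imp_le less_irrefl less_le_trans order_le_less)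
    moreover have "i' < Suc i" using assms i' kappa_less[of "Suc i" i'] kappa_less
      by (metis less_asym less_imp_le less_irrefl linorder_neqE_nat)
    ultimately show False by simp
  next
    case False
    have "Suc i = n"
    proof (rule ccontr)
      assume "Suc i \<noteq> n"
      then have "\<kappa> (Suc i) \<in> ones" using assms(1) by (intro kappa_in) simp
      then show False using False assms(3) by (simp add: ones_def)
    qed
    then have "j - 2 * int n < \<kappa> 0" using assms(3) kappa_n by simp
    moreover have "\<kappa> 0 < 2 * int n" using kappa_in[of 0] n3 by (simp add: ones_def)
    moreover have "W (j - 2 * int n) = 1" using W_period[of "j - 2 * int n"] Wj by simp
    ultimately have "j - 2 * int n \<in> ones" using False by (simp add: ones_def)
    then obtain i' where "i' < n" "j - 2 * int n = \<kappa> i'" using kappa_image by blast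
    then show False using kappa_less[of 0 i'] \<open>j - 2 * int n < \<kappa> 0\<close> by (cases "i' = 0") auto
  qed
qed

lemma kappa_cover:
  obtains j q where "j < n" "\<kappa> j + 2 * int n * q \<le> k" "k < \<kappa> (Suc j) + 2 * int n * q"
proof -
  have cover: "\<exists>j<N. \<kappa> j \<le> x \<and> x < \<kappa> (Suc j)" if "\<kappa> 0 \<le> x" "x < \<kappa> N" for x N
    using that
  proof (induction N)
    case (Suc N)
    show ?case
    proof (cases "x < \<kappa> N")
      case True
      with Suc show ?thesis by (metis less_Suc_eq)
    next
      case False
      with Suc show ?thesis by (intro exI[of _ N]) auto
    qed
  qed simp
  define q where "q = (k - \<kappa> 0) div (2 * int n)"
  have "k - \<kappa> 0 = 2 * int n * q + (k - \<kappa> 0) mod (2 * int n)" by (simp add: q_def)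
  moreover have "0 \<le> (k - \<kappa> 0) mod (2 * int n)" "(k - \<kappa> 0) mod (2 * int n) < 2 * int n" using n3 by auto
  ultimately have "\<kappa> 0 \<le> k - 2 * int n * q" "k - 2 * int n * q < \<kappa> n" unfolding kappa_n by linarith+
  from cover[OF this] show ?thesis using that[of _ q] by (auto simp: algebra_simps)
qed

lemma card_kappa: "card {j. j < n \<and> (\<kappa> j - e) mod (2 * int n) = 0} = W e"
proof (cases "W e = 1")
  case True
  define x where "x = e mod (2 * int n)"
  have "e = x + 2 * int n * (e div (2 * int n))" by (simp add: x_def)
  then have "W x = 1" using True W_shift[of x] by metis
  then have "x \<in> ones" using n3 by (simp add: ones_def x_def)
  then obtain i where i: "i < n" "x = \<kappa> i" using kappa_image by blast
  have iff: "(\<kappa> j - e) mod (2 * int n) = 0 \<longleftrightarrow> j = i" if "j < n" for j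
  proof -
    have "(\<kappa> j - e) mod (2 * int n) = 0 \<longleftrightarrow> \<kappa> j mod (2 * int n) = x"
      unfolding x_def by (simp add: mod_eq_dvd_iff mod_eq_0_iff_dvd)
    also have "\<dots> \<longleftrightarrow> \<kappa> j = \<kappa> i" using kappa_in[OF that] i by (simp add: ones_def)
    also have "\<dots> \<longleftrightarrow> j = i" using kappa_less[of i j] kappa_less[of j i] that i
      by (metis less_imp_le less_irrefl linorder_neqE_nat)
    finally show ?thesis .
  qed
  have "{j. j < n \<and> (\<kappa> j - e) mod (2 * int n) = 0} = {i}"
  proof (intro set_eqI, unfold mem_Collect_eq singleton_iff)
    show "j < n \<and> (\<kappa> j - e) mod (2 * int n) = 0 \<longleftrightarrow> j = i" for j using iff[of j] i(1) by metis
  qed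
  then show ?thesis using True by simp
next
  case False
  have "(\<kappa> j - e) mod (2 * int n) \<noteq> 0" if "j < n" for j
  proof
    assume "(\<kappa> j - e) mod (2 * int n) = 0"
    then obtain q where q: "\<kappa> j - e = 2 * int n * q" by (auto simp: mod_eq_0_iff_dvd dvd_def)
    then have "\<kappa> j = e + 2 * int n * q" by simp
    then show False using W_shift[of e q] W_kappa[of j] that False by simp
  qed
  then have "{j. j < n \<and> (\<kappa> j - e) mod (2 * int n) = 0} = {}" by auto
  then show ?thesis using False W01[of e] by simp
qed

section \<open>Counts of points and midpoints at the slots\<close>

definition \<theta> :: "nat \<Rightarrow> real" where
  "\<theta> i = pos (\<kappa> i)"

sublocale circle_points n \<theta>
proof
  show "\<theta> n = \<theta> 0 + 2 * pi" unfolding \<theta>_def kappa_n using pos_shift[of "\<kappa> 0" 2] by simp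
  show "\<theta> i < \<theta> (Suc i)" if "i < n" for i
    unfolding \<theta>_def using that by (intro pos_less kappa_less) auto
qed (use n3 in simp)

lemma theta_shift: "\<theta> i + 2 * pi * of_int q = pos (\<kappa> i + 2 * int n * q)"
  using pos_shift[of "\<kappa> i" "2 * q"] by (simp add: \<theta>_def algebra_simps)

lemma mid_theta_vs_pos:
  assumes W: "W k = 0" "W (k + int n) = 1" and j: "j < n"
    and k: "\<kappa> j + 2 * int n * q < k" "k < \<kappa> (Suc j) + 2 * int n * q"
  shows "if D k = 0 then mid \<theta> j + 2 * pi * of_int q < pos k else pos k < mid \<theta> j + 2 * pi * of_int q"
proof -
  have "W x = 0" if "\<kappa> j + 2 * int n * q < x" "x < \<kappa> (Suc j) + 2 * int n * q" for x
    using kappa_consecutive[OF j, of "x - 2 * int n * q"] W_shift[of "x - 2 * int n * q" q] that by simp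
  note * = antipode_vs_midpoint[OF W k this]
  have "2 * (mid \<theta> j + 2 * pi * of_int q) = pos (\<kappa> j + 2 * int n * q) + pos (\<kappa> (Suc j) + 2 * int n * q)"
    by (simp only: theta_shift[symmetric]) (simp add: mid_def field_simps)
  then show ?thesis using * D01[of k] by auto
qed

lemma drift_pos_1:
  assumes "W k = 1" shows "drift (pos k) = 1"
proof -
  obtain j q where jq: "j < n" "\<kappa> j + 2 * int n * q \<le> k" "k < \<kappa> (Suc j) + 2 * int n * q"
    by (rule kappa_cover)
  have "k = \<kappa> j + 2 * int n * q"
    using kappa_consecutive[OF jq(1), of "k - 2 * int n * q"] W_shift[of "k - 2 * int n * q" q] jq assms
    by (cases "k = \<kappa> j + 2 * int n * q") auto
  then have "\<theta> j + 2 * pi * of_int q = pos k" by (simp add: theta_shift)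
  then show ?thesis using mid_between[OF jq(1)] by (intro drift_eq_1[OF jq(1), of q]) auto
qed

text \<open>If \<open>D k = 0\<close>, the slot lies past the midpoint of the two surrounding
  points, so a midpoint was met last; if \<open>D k = 1\<close>, it lies before that midpoint and a
  point was met last.\<close>

lemma drift_pos_0:
  assumes W: "W k = 0" "W (k + int n) = 1" shows "drift (pos k) = D k"
proof -
  obtain j q where jq: "j < n" "\<kappa> j + 2 * int n * q \<le> k" "k < \<kappa> (Suc j) + 2 * int n * q"
    by (rule kappa_cover)
  have "k \<noteq> \<kappa> j + 2 * int n * q" using W_shift W_kappa[of j] W(1) jq(1) by auto
  then have lt: "\<kappa> j + 2 * int n * q < k" using jq by simp
  have "\<theta> j + 2 * pi * of_int q < pos k" "pos k < \<theta> (Suc j) + 2 * pi * of_int q"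
    unfolding theta_shift using lt jq by (auto simp: pos_less_iff)
  then show ?thesis
    using mid_theta_vs_pos[OF W jq(1) lt jq(3)] drift_eq_1[OF jq(1), of q "pos k"]
      drift_eq_0[OF jq(1), of q "pos k"] D01[of k] by (auto split: if_splits)
qed

text \<open>As \<open>pos\<close> is increasing and turns a shift by \<open>n\<close> into
  \<open>pi\<close>, comparing angles amounts to comparing indices.\<close>

lemma floor_count_theta_pos: "floor_count n \<theta> (pos k) = div_sum n \<kappa> k"
  unfolding floor_count_def div_sum_def
proof (intro sum.cong refl)
  fix i
  define q where "q = (k - \<kappa> i) div int n"
  have "k - \<kappa> i = int n * q + (k - \<kappa> i) mod int n" by (simp add: q_def)
  moreover have "0 \<le> (k - \<kappa> i) mod int n" "(k - \<kappa> i) mod int n < int n" using n3 by auto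
  ultimately have "\<kappa> i + q * int n \<le> k" "k < \<kappa> i + (q + 1) * int n" by (auto simp: algebra_simps)
  then have "\<theta> i + of_int q * pi \<le> pos k" "pos k < \<theta> i + of_int (q + 1) * pi"
    unfolding \<theta>_def pos_shift[symmetric] by (simp_all only: pos_le_iff pos_less_iff)
  then have "of_int q \<le> (pos k - \<theta> i) / pi" "(pos k - \<theta> i) / pi < of_int q + 1"
    by (auto simp: pos_le_divide_eq pos_divide_less_eq algebra_simps)
  then show "\<lfloor>(pos k - \<theta> i) / pi\<rfloor> = (k - \<kappa> i) div int n"
    unfolding q_def[symmetric] by (intro floor_unique)
qed

text \<open>Moving on to slot \<open>k + 1\<close> adds the number of points in its antipodal pair,
  which by \<open>pair\<close> is 1 plus the increment of \<open>D\<close>; the difference of both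
  sides stays constant.\<close>

lemma div_sum_kappa: "div_sum n \<kappa> k = k + D (k + 1) + (div_sum n \<kappa> 0 - D 1)"
proof -
  have "div_sum n \<kappa> k - k - D (k + 1) = div_sum n \<kappa> 0 - 0 - D (0 + 1)"
  proof (rule int_constant)
    fix k
    have *: "(\<kappa> j - e) mod (2 * int n) = 0 + int n \<longleftrightarrow> (\<kappa> j - (e + int n)) mod (2 * int n) = 0" for j e
    proof -
      have "(\<kappa> j - e) mod (2 * int n) = int n mod (2 * int n) \<longleftrightarrow> (\<kappa> j - (e + int n)) mod (2 * int n) = 0"
        by (simp only: mod_eq_dvd_iff mod_eq_0_iff_dvd) (simp add: algebra_simps)
      moreover have "int n mod (2 * int n) = int n" using n3 by simp
      ultimately show ?thesis by simp
    qed
    have "card {j. j < n \<and> (\<kappa> j - (k + 1)) mod int n = 0} = W (k + 1) + W (k + 1 + int n)"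
      using card_mod_split[of 0 n \<kappa> "k + 1"] n3 unfolding * card_kappa by simp
    then have "div_sum n \<kappa> (k + 1) = div_sum n \<kappa> k + (1 + D (k + 1 + 1) - D (k + 1))"
      using div_sum_step[of n \<kappa> k] n3 pair[of "k + 1"] by simp
    then show "div_sum n \<kappa> (k + 1) - (k + 1) - D (k + 1 + 1) = div_sum n \<kappa> k - k - D (k + 1)" by simp
  qed
  then show ?thesis by simp
qed

text \<open>At an occupied slot \<open>k\<close> the two drifts add up to
  \<open>1 + D (k + 1)\<close>, whether or not its antipode is occupied. Subtracting them from the
  count of points cancels the height in \<open>div_sum_kappa\<close> and leaves the slot number up
  to a constant.\<close>

lemma floor_count_mid_theta:
  assumes "j < n"
  shows "floor_count n (mid \<theta>) (\<theta> j) = \<kappa> j + (div_sum n \<kappa> 0 - D 1 - 1)"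
proof -
  let ?k = "\<kappa> j"
  have W: "W ?k = 1" using W_kappa assms by simp
  have "drift (pos ?k) + drift (pos ?k + pi) = 1 + D (?k + 1)"
  proof (cases "W (?k + int n) = 1")
    case True
    then have "D (?k + 1) = 1" using pair[of ?k] W D01[of ?k] D01[of "?k + 1"] by auto
    then show ?thesis using drift_pos_1[OF W] drift_pos_1[OF True] pos_period by simp
  next
    case False
    then have W0: "W (?k + int n) = 0" using W01 by metis
    have "W (?k + int n + int n) = 1" using W_period[of ?k] W by (simp add: algebra_simps)
    then have "drift (pos ?k + pi) = D ?k"
      using drift_pos_0[OF W0] pos_period D_period by simp
    moreover have "D (?k + 1) = D ?k" using pair[of ?k] W W0 by simp
    ultimately show ?thesis using drift_pos_1[OF W] by simp
  qed
  then show ?thesis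
    using floor_count_diff[of "\<theta> j"] floor_count_theta_pos[of ?k] div_sum_kappa[of ?k]
    by (simp add: \<theta>_def)
qed

text \<open>A midpoint congruent to a point modulo \<open>pi\<close> would sit at a slot strictly
  between two consecutive points. That slot is empty, so its antipode is occupied, and then
  \<open>mid_theta_vs_pos\<close> separates the slot strictly from the midpoint.\<close>

lemma theta_off_lines:
  assumes "i < n" "j < n" shows "sin (\<theta> j - mid \<theta> i) \<noteq> 0"
proof
  assume "sin (\<theta> j - mid \<theta> i) = 0"
  then obtain a :: int where a: "\<theta> j - mid \<theta> i = of_int a * pi" using sin_zero_iff_int2 by blast
  define k where "k = \<kappa> j + (- a) * int n"
  have mk: "mid \<theta> i = pos k" unfolding k_def pos_shift using a by (simp add: \<theta>_def)
  have lt: "\<kappa> i < k" "k < \<kappa> (Suc i)"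
    using mid_between[OF assms(1)] unfolding mk by (simp_all add: \<theta>_def pos_less_iff)
  have W: "W k = 0" using kappa_consecutive[OF assms(1) lt] .
  have "W (k + int n) = 1"
  proof (cases "even a")
    case True
    then obtain b where "a = 2 * b" by blast
    then have "k = \<kappa> j + 2 * int n * (- b)" by (simp add: k_def algebra_simps)
    then show ?thesis using W W_shift[of "\<kappa> j" "- b"] W_kappa[of j] assms by simp
  next
    case False
    then obtain b where "a = 2 * b + 1" by (rule oddE)
    then have "k + int n = \<kappa> j + 2 * int n * (- b)" by (simp add: k_def algebra_simps)
    then show ?thesis using W_shift[of "\<kappa> j" "- b"] W_kappa[of j] assms by simp
  qed
  from mid_theta_vs_pos[OF W this assms(1), of 0] show False
    using lt mk by (auto split: if_splits)
qed

lemma word_realizable: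
  assumes "w \<in> binary_words (2 * n)" "\<And>k. k < 2 * n \<Longrightarrow> w ! k = W (int k)"
  shows "w \<in> realizable_words n"
proof -
  obtain \<theta>' where "generic_points n \<theta>'"
    and L: "\<forall>j<n. floor_count n (mid \<theta>') (\<theta>' j) = floor_count n (mid \<theta>) (\<theta> j)"
    using perturb[OF n3] theta_off_lines by metis
  then interpret S: generic_points n \<theta>' by blast
  show ?thesis
  proof (rule S.realizableI)
    show "\<forall>j<n. floor_count n (mid \<theta>') (\<theta>' j) = \<kappa> j + (div_sum n \<kappa> 0 - D 1 - 1)"
      using L floor_count_mid_theta by simp
    show "\<forall>k<2 * n. w ! k = card {j. j < n \<and> \<kappa> j mod (2 * int n) = int k}"
    proof (intro allI impI)
      fix k assume k: "k < 2 * n"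
      have "\<kappa> j mod (2 * int n) = int k mod (2 * int n) \<longleftrightarrow> (\<kappa> j - int k) mod (2 * int n) = 0" for j
        by (simp only: mod_eq_dvd_iff mod_eq_0_iff_dvd)
      then have "\<kappa> j mod (2 * int n) = int k \<longleftrightarrow> (\<kappa> j - int k) mod (2 * int n) = 0" for j
        using k by simp
      then show "w ! k = card {j. j < n \<and> \<kappa> j mod (2 * int n) = int k}"
        using card_kappa[of "int k"] assms(2)[OF k] by simp
    qed
  qed (rule assms(1))
qed

end

section \<open>From finite words to periodic sequences and back\<close>

lemma balanced_imp_realizable:
  assumes "3 \<le> n" and w: "w \<in> binary_words (2 * n)" and "balanced n w"
  shows "w \<in> realizable_words n"
proof -
  obtain D :: "nat \<Rightarrow> int" and r where D: "\<And>k. k \<le> n \<Longrightarrow> D k = 0 \<or> D k = 1" "D n = D 0"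
    "\<And>k. k < n \<Longrightarrow> int (w ! k) + int (w ! (k + n)) = 1 + D (Suc k) - D k"
    and r: "r < n" "D (Suc r) \<noteq> D r"
    using assms(3) unfolding balanced_def by blast
  define W where "W k = w ! nat (k mod (2 * int n))" for k
  define D' where "D' k = D (nat (k mod int n))" for k
  have n: "0 < int n" using assms by simp
  have D'1: "D' (k + 1) = D (Suc (nat (k mod int n)))" for k
  proof -
    have b: "0 \<le> k mod int n" "k mod int n < int n" using n by auto
    have "(k + 1) mod int n = (k mod int n + 1) mod int n" by (simp add: mod_add_left_eq)
    also have "\<dots> = (if k mod int n + 1 = int n then 0 else k mod int n + 1)" using b by auto
    finally have e: "(k + 1) mod int n = (if k mod int n + 1 = int n then 0 else k mod int n + 1)" .
    show ?thesis
    proof (cases "k mod int n + 1 = int n")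
      case True
      then have "Suc (nat (k mod int n)) = n" using b by linarith
      then show ?thesis using True e D(2) by (simp add: D'_def)
    next
      case False
      then show ?thesis using e b by (simp add: D'_def nat_add_distrib)
    qed
  qed
  have "balanced_sequence n W D' (int r)"
  proof
    show "3 \<le> n" by fact
    fix k :: int
    show "W (k + 2 * int n) = W k" by (simp add: W_def)
    show "W k = 0 \<or> W k = 1"
    proof -
      have "nat (k mod (2 * int n)) < length w"
        using w n by (simp add: binary_words_def nat_less_iff)
      then have "W k \<in> set w" by (simp add: W_def)
      then show ?thesis using w by (auto simp: binary_words_def)
    qed
    show "D' (k + int n) = D' k" by (simp add: D'_def)
    show "D' k = 0 \<or> D' k = 1" using n D(1)[of "nat (k mod int n)"]
      by (simp add: D'_def nat_le_iff less_imp_le)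
    show "int (W k) + int (W (k + int n)) = 1 + D' (k + 1) - D' k"
    proof -
      define c where "c = nat (k mod int n)"
      have c: "c < n" "int c = k mod int n" using n by (auto simp: c_def nat_less_iff)
      define q where "q = k div int n"
      have k: "k = int c + int n * q" using c by (simp add: q_def)
      \<comment> \<open>The parity of \<open>q\<close> decides which of the two letters belongs to
        \<open>k\<close> and which to \<open>k + n\<close>; their sum is the same either
        way.\<close>
      have "{nat (k mod (2 * int n)), nat ((k + int n) mod (2 * int n))} = {c, c + n} \<and>
        nat (k mod (2 * int n)) \<noteq> nat ((k + int n) mod (2 * int n))"
      proof (cases "even q")
        case True
        then obtain b where "q = 2 * b" by blast
        then have e: "k = int c + 2 * int n * b" "k + int n = int (c + n) + 2 * int n * b" using k by auto
        have "k mod (2 * int n) = int c" unfolding e(1) using c(1) by simp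
        moreover have "(k + int n) mod (2 * int n) = int (c + n)" unfolding e(2) using c(1) by simp
        ultimately show ?thesis using n by auto
      next
        case False
        then obtain b where "q = 2 * b + 1" by (rule oddE)
        then have e: "k = int (c + n) + 2 * int n * b" "k + int n = int c + 2 * int n * (b + 1)"
          using k by (auto simp: algebra_simps)
        have "k mod (2 * int n) = int (c + n)" unfolding e(1) using c(1) by simp
        moreover have "(k + int n) mod (2 * int n) = int c" unfolding e(2) using c(1) by simp
        ultimately show ?thesis using n by auto
      qed
      then have "int (W k) + int (W (k + int n)) = int (w ! c) + int (w ! (c + n))"
        unfolding W_def by (auto simp: doubleton_eq_iff)
      then show ?thesis using D(3)[OF c(1)] D'1[of k] by (simp add: D'_def c_def)
    qed
    show "D' (int r + 1) \<noteq> D' (int r)" using D'1[of "int r"] r by (simp add: D'_def)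
  qed
  then interpret balanced_sequence n W D' "int r" .
  show ?thesis
    by (rule word_realizable[OF w]) (simp add: W_def)
qed

lemma realizable_imp_balanced:
  assumes "3 \<le> n" "w \<in> realizable_words n"
  shows "balanced n w"
proof -
  obtain P R where PR: "generic n P" "region_numbering n P R" "w = occupancy n P R"
    using assms by (auto simp: realizable_words_def)
  obtain \<theta> where "generic_points n \<theta>" and P: "\<forall>i<n. P i = cis (\<theta> i)"
    using generic_imp_generic_points[OF PR(1) assms(1)] by blast
  then interpret generic_points n \<theta> by blast
  show ?thesis using occupancy_balanced[OF P PR(2)] PR(3) by simp
qed

lemma realizable_words_eq:
  "3 \<le> n \<Longrightarrow> realizable_words n = {w \<in> binary_words (2 * n). balanced n w}"
  using balanced_imp_realizable realizable_imp_balanced unfolding realizable_words_def by blast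

section \<open>Counting\<close>

lemma card_binary_words: "finite (binary_words m)" "card (binary_words m) = 2 ^ m"
proof -
  have e: "binary_words m = {w. set w \<subseteq> {0, 1} \<and> length w = m}" by (auto simp: binary_words_def)
  show "finite (binary_words m)" unfolding e by (rule finite_lists_length_eq) simp
  show "card (binary_words m) = 2 ^ m" unfolding e by (subst card_lists_length_eq) (simp_all add: numeral_2_eq_2)
qed

text \<open>\<open>walk a ps b\<close>: reading the antipodal pairs \<open>ps\<close> moves the height \<open>D\<close> of \<open>balanced\<close>
  from \<open>a\<close> to \<open>b\<close>.\<close>

fun walk :: "int \<Rightarrow> (nat \<times> nat) list \<Rightarrow> int \<Rightarrow> bool" where
  "walk a [] b \<longleftrightarrow> a = b"
| "walk a ((x, y) # ps) b \<longleftrightarrow> x \<in> {0, 1} \<and> y \<in> {0, 1} \<and> a + int x + int y - 1 \<in> {0, 1} \<and>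
    walk (a + int x + int y - 1) ps b"

definition walks :: "int \<Rightarrow> nat \<Rightarrow> int \<Rightarrow> (nat \<times> nat) list set" where
  "walks a n b = {ps. length ps = n \<and> walk a ps b}"

lemma walks_0: "walks a 0 b = (if a = b then {[]} else {})"
  by (auto simp: walks_def)

lemma walks_Suc:
  "walks 0 (Suc n) b = Cons (0, 1) ` walks 0 n b \<union> Cons (1, 0) ` walks 0 n b \<union> Cons (1, 1) ` walks 1 n b"
  "walks 1 (Suc n) b = Cons (0, 1) ` walks 1 n b \<union> Cons (1, 0) ` walks 1 n b \<union> Cons (0, 0) ` walks 0 n b"
proof -
  show "walks 0 (Suc n) b = Cons (0, 1) ` walks 0 n b \<union> Cons (1, 0) ` walks 0 n b \<union> Cons (1, 1) ` walks 1 n b"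
  proof (rule set_eqI)
    fix ps show "ps \<in> walks 0 (Suc n) b \<longleftrightarrow>
        ps \<in> Cons (0, 1) ` walks 0 n b \<union> Cons (1, 0) ` walks 0 n b \<union> Cons (1, 1) ` walks 1 n b"
    proof (cases ps)
      case (Cons p qs)
      then show ?thesis by (cases p) (auto simp: walks_def image_iff)
    qed (auto simp: walks_def)
  qed
  show "walks 1 (Suc n) b = Cons (0, 1) ` walks 1 n b \<union> Cons (1, 0) ` walks 1 n b \<union> Cons (0, 0) ` walks 0 n b"
  proof (rule set_eqI)
    fix ps show "ps \<in> walks 1 (Suc n) b \<longleftrightarrow>
        ps \<in> Cons (0, 1) ` walks 1 n b \<union> Cons (1, 0) ` walks 1 n b \<union> Cons (0, 0) ` walks 0 n b"
    proof (cases ps)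
      case (Cons p qs)
      then show ?thesis by (cases p) (auto simp: walks_def image_iff)
    qed (auto simp: walks_def)
  qed
qed

text \<open>The entries of the powers of the transfer matrix, (3^n + 1) / 2 on the diagonal and (3^n
  - 1) / 2 off it, written without division and subtraction of naturals.\<close>

lemma card_walks:
  "finite (walks 0 n b) \<and> finite (walks 1 n b) \<and>
   2 * card (walks 0 n 0) = 3 ^ n + 1 \<and> 2 * card (walks 1 n 0) + 1 = 3 ^ n \<and>
   2 * card (walks 0 n 1) + 1 = 3 ^ n \<and> 2 * card (walks 1 n 1) = 3 ^ n + 1"
proof -
  have fin: "finite (walks 0 n b) \<and> finite (walks 1 n b)" for n b
    by (induction n) (auto simp: walks_0 walks_Suc)
  have c: "card (walks 0 (Suc n) b) = 2 * card (walks 0 n b) + card (walks 1 n b)"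
    "card (walks 1 (Suc n) b) = 2 * card (walks 1 n b) + card (walks 0 n b)" for n b
    unfolding walks_Suc using fin
    by (subst card_Un_disjoint; (subst card_Un_disjoint)?; auto simp: card_image)+
  have "2 * card (walks 0 n 0) = 3 ^ n + 1 \<and> 2 * card (walks 1 n 0) + 1 = 3 ^ n \<and>
   2 * card (walks 0 n 1) + 1 = 3 ^ n \<and> 2 * card (walks 1 n 1) = 3 ^ n + 1"
    by (induction n) (simp add: walks_0, simp add: c)
  then show ?thesis using fin by blast
qed

lemma walk_iff:
  "walk a ps b \<longleftrightarrow> set ps \<subseteq> {0, 1} \<times> {0, 1} \<and> 
    (\<exists>D :: nat \<Rightarrow> int. D 0 = a \<and> D (length ps) = b \<and> (\<forall>k<length ps. D (Suc k) \<in> {0, 1} \<and>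
      int (fst (ps ! k)) + int (snd (ps ! k)) = 1 + D (Suc k) - D k))"
proof (induction a ps b rule: walk.induct)
  case (1 a b)
  show ?case by (auto intro: exI[of _ "\<lambda>_. a"])
next
  case (2 a x y ps b)
  let ?c = "a + int x + int y - 1"
  show ?case
  proof
    assume "walk a ((x, y) # ps) b"
    then have xy: "x \<in> {0, 1}" "y \<in> {0, 1}" "?c \<in> {0, 1}" "walk ?c ps b" by auto
    then obtain D :: "nat \<Rightarrow> int" where D: "D 0 = ?c" "D (length ps) = b"
      "\<forall>k<length ps. D (Suc k) \<in> {0, 1} \<and> int (fst (ps ! k)) + int (snd (ps ! k)) = 1 + D (Suc k) - D k"
      and ps: "set ps \<subseteq> {0, 1} \<times> {0, 1}"
      using 2 by blast
    let ?D = "\<lambda>k. case k of 0 \<Rightarrow> a | Suc j \<Rightarrow> D j"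
    have "?D (Suc k) \<in> {0, 1} \<and>
      int (fst (((x, y) # ps) ! k)) + int (snd (((x, y) # ps) ! k)) = 1 + ?D (Suc k) - ?D k"
      if "k < length ((x, y) # ps)" for k
      using that D xy by (cases k) auto
    moreover have "?D 0 = a" "?D (length ((x, y) # ps)) = b" using D by auto
    moreover have "set ((x, y) # ps) \<subseteq> {0, 1} \<times> {0, 1}" using ps xy by auto
    ultimately show "set ((x, y) # ps) \<subseteq> {0, 1} \<times> {0, 1} \<and> (\<exists>D :: nat \<Rightarrow> int. D 0 = a \<and> D (length ((x, y) # ps)) = b \<and>
      (\<forall>k<length ((x, y) # ps). D (Suc k) \<in> {0, 1} \<and>
        int (fst (((x, y) # ps) ! k)) + int (snd (((x, y) # ps) ! k)) = 1 + D (Suc k) - D k))"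
      by blast
  next
    assume R: "set ((x, y) # ps) \<subseteq> {0, 1} \<times> {0, 1} \<and> (\<exists>D :: nat \<Rightarrow> int. D 0 = a \<and> D (length ((x, y) # ps)) = b \<and>
      (\<forall>k<length ((x, y) # ps). D (Suc k) \<in> {0, 1} \<and>
        int (fst (((x, y) # ps) ! k)) + int (snd (((x, y) # ps) ! k)) = 1 + D (Suc k) - D k))"
    then obtain D :: "nat \<Rightarrow> int" where D: "D 0 = a" "D (Suc (length ps)) = b"
      "\<And>k. k < Suc (length ps) \<Longrightarrow> D (Suc k) \<in> {0, 1} \<and>
        int (fst (((x, y) # ps) ! k)) + int (snd (((x, y) # ps) ! k)) = 1 + D (Suc k) - D k"
      by auto
    have c: "D 1 = ?c" "?c \<in> {0, 1}" using D(3)[of 0] D(1) by auto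
    have "walk ?c ps b"
      unfolding 2
    proof (intro conjI exI[of _ "\<lambda>k. D (Suc k)"] allI impI)
      show "set ps \<subseteq> {0, 1} \<times> {0, 1}" using R by auto
      fix k assume "k < length ps"
      then show "D (Suc (Suc k)) \<in> {0, 1}"
        "int (fst (ps ! k)) + int (snd (ps ! k)) = 1 + D (Suc (Suc k)) - D (Suc k)"
        using D(3)[of "Suc k"] by auto
    qed (use c D in auto)
    then show "walk a ((x, y) # ps) b" using R c by auto
  qed
qed

definition flat_pairs :: "nat \<Rightarrow> (nat \<times> nat) list set" where
  "flat_pairs n = {ps. set ps \<subseteq> {(0, 1), (1, 0)} \<and> length ps = n}"

lemma card_flat_pairs: "finite (flat_pairs n)" "card (flat_pairs n) = 2 ^ n"
  unfolding flat_pairs_def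
  by (rule finite_lists_length_eq, simp) (subst card_lists_length_eq, simp_all add: numeral_2_eq_2)

lemma walk_flat: "set ps \<subseteq> {(0, 1), (1, 0)} \<Longrightarrow> a \<in> {0, 1} \<Longrightarrow> walk a ps a"
  by (induction a ps a rule: walk.induct) auto

text \<open>The pair \<open>(1, 1)\<close> can be read only at height 0 and \<open>(0, 0)\<close>
  only at height 1. Two walks along the same list stay one apart, so neither pair can occur.\<close>

lemma walk_both: "walk 0 ps c \<Longrightarrow> walk 1 ps d \<Longrightarrow> set ps \<subseteq> {(0, 1), (1, 0)}"
proof (induction ps)
  case (Cons p ps)
  then show ?case by (cases p) auto
qed simp

lemma walks_inter: "walks 0 n 0 \<inter> walks 1 n 1 = flat_pairs n"
proof (intro set_eqI iffI)
  fix ps assume "ps \<in> walks 0 n 0 \<inter> walks 1 n 1"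
  then show "ps \<in> flat_pairs n" using walk_both[of ps 0 1] unfolding walks_def flat_pairs_def by blast
next
  fix ps assume "ps \<in> flat_pairs n"
  then show "ps \<in> walks 0 n 0 \<inter> walks 1 n 1"
    using walk_flat[of ps 0] walk_flat[of ps 1] unfolding walks_def flat_pairs_def by simp
qed

definition join_pairs :: "(nat \<times> nat) list \<Rightarrow> nat list" where
  "join_pairs ps = map fst ps @ map snd ps"

lemma inj_join_pairs: "inj_on join_pairs {ps. length ps = n}"
  by (rule inj_onI) (auto simp: join_pairs_def intro: pair_list_eqI)

text \<open>The witness \<open>D\<close> is the sequence of heights visited by a closed walk; it is
  nonconstant exactly when some antipodal pair is full or empty.\<close>

lemma balanced_words_eq:
  "{w \<in> binary_words (2 * n). balanced n w} =
    join_pairs ` ((walks 0 n 0 \<union> walks 1 n 1) - flat_pairs n)"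
proof (intro set_eqI iffI)
  fix w assume "w \<in> {w \<in> binary_words (2 * n). balanced n w}"
  then have w: "length w = 2 * n" "set w \<subseteq> {0, 1}" and b: "balanced n w" by (auto simp: binary_words_def)
  from b obtain D :: "nat \<Rightarrow> int" and r where D: "\<And>k. k \<le> n \<Longrightarrow> D k = 0 \<or> D k = 1" "D n = D 0"
    "\<And>k. k < n \<Longrightarrow> int (w ! k) + int (w ! (k + n)) = 1 + D (Suc k) - D k"
    and r: "r < n" "D (Suc r) \<noteq> D r"
    unfolding balanced_def by blast
  define ps where "ps = zip (take n w) (drop n w)"
  have len: "length ps = n" using w by (simp add: ps_def)
  have nth: "ps ! k = (w ! k, w ! (k + n))" if "k < n" for k
    using that w by (simp add: ps_def add.commute)
  have join: "join_pairs ps = w" using w by (simp add: join_pairs_def ps_def)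
  have set_ps: "set ps \<subseteq> {0, 1} \<times> {0, 1}"
  proof
    fix p assume "p \<in> set ps"
    then obtain k where k: "k < n" "p = ps ! k" using len by (metis in_set_conv_nth)
    then have "w ! k \<in> set w" "w ! (k + n) \<in> set w" using w by auto
    then show "p \<in> {0, 1} \<times> {0, 1}" using w nth[OF k(1)] k(2) by auto
  qed
  have "walk (D 0) ps (D 0)"
    unfolding walk_iff len using D nth set_ps by (intro conjI exI[of _ D]) auto
  moreover have "D 0 = 0 \<or> D 0 = 1" using D(1) by simp
  ultimately have "ps \<in> walks 0 n 0 \<union> walks 1 n 1" using len by (auto simp: walks_def)
  moreover have "ps \<notin> flat_pairs n"
  proof
    assume "ps \<in> flat_pairs n"
    moreover have "ps ! r \<in> set ps" using r len by simp
    ultimately have "ps ! r \<in> {(0, 1), (1, 0)}" by (auto simp: flat_pairs_def)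
    then show False using nth[OF r(1)] D(3)[OF r(1)] r(2) by auto
  qed
  ultimately show "w \<in> join_pairs ` ((walks 0 n 0 \<union> walks 1 n 1) - flat_pairs n)"
    using join by blast
next
  fix w assume "w \<in> join_pairs ` ((walks 0 n 0 \<union> walks 1 n 1) - flat_pairs n)"
  then obtain ps a where ps: "w = join_pairs ps" "length ps = n" "walk a ps a" "a = 0 \<or> a = 1"
    "ps \<notin> flat_pairs n" by (auto simp: walks_def)
  obtain D :: "nat \<Rightarrow> int" where D: "D 0 = a" "D n = a"
      "\<forall>k<n. D (Suc k) \<in> {0, 1} \<and> int (fst (ps ! k)) + int (snd (ps ! k)) = 1 + D (Suc k) - D k"
    and set_ps: "set ps \<subseteq> {0, 1} \<times> {0, 1}"
    using ps(2,3) unfolding walk_iff by blast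
  have w: "w ! k = fst (ps ! k)" "w ! (k + n) = snd (ps ! k)" if "k < n" for k
    using that ps by (auto simp: join_pairs_def nth_append)
  have "w \<in> binary_words (2 * n)" using ps set_ps by (force simp: binary_words_def join_pairs_def)
  moreover have "balanced n w"
    unfolding balanced_def
  proof (intro exI[of _ D] conjI allI impI)
    show "D k = 0 \<or> D k = 1" if "k \<le> n" for k using that D ps by (cases k) auto
    show "D n = D 0" using D by simp
    show "int (w ! k) + int (w ! (k + n)) = 1 + D (Suc k) - D k" if "k < n" for k
      using D w that by simp
    obtain p where p: "p \<in> set ps" "p \<notin> {(0, 1), (1, 0)}" using ps by (auto simp: flat_pairs_def)
    then obtain k where k: "k < n" "p = ps ! k" using ps by (metis in_set_conv_nth)
    have "D (Suc k) \<noteq> D k" using D(3) k p set_ps by (cases p) force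
    then show "\<exists>k<n. D (Suc k) \<noteq> D k" using k by blast
  qed
  ultimately show "w \<in> {w \<in> binary_words (2 * n). balanced n w}" by simp
qed

text \<open>The trace 3^n + 1 counts each flat list twice, since it is a closed walk from either
  height. One copy goes in forming the union and the other in removing the flat lists, hence 2 * 2^n
  in all.\<close>

lemma card_balanced_words:
  "int (card {w \<in> binary_words (2 * n). balanced n w}) = 3 ^ n - 2 ^ (n + 1) + 1"
proof -
  let ?V = "walks 0 n 0 \<union> walks 1 n 1"
  have fin: "finite (walks 0 n 0)" "finite (walks 1 n 1)" using card_walks by blast+
  have sub: "flat_pairs n \<subseteq> ?V" using walks_inter by blast
  have "card {w \<in> binary_words (2 * n). balanced n w} = card (?V - flat_pairs n)"
    unfolding balanced_words_eq
    by (intro card_image inj_on_subset[OF inj_join_pairs[of n]]) (auto simp: walks_def)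
  also have "\<dots> = card ?V - 2 ^ n" using sub card_flat_pairs by (simp add: card_Diff_subset)
  finally have count: "int (card {w \<in> binary_words (2 * n). balanced n w}) = int (card ?V) - 2 ^ n"
    using card_mono[OF _ sub] fin card_flat_pairs by (simp add: of_nat_diff)
  have "card (walks 0 n 0) + card (walks 1 n 1) = card ?V + 2 ^ n"
    using card_Un_Int[OF fin] unfolding walks_inter card_flat_pairs(2) .
  moreover have "2 * card (walks 0 n 0) = 3 ^ n + 1" "2 * card (walks 1 n 1) = 3 ^ n + 1"
    using card_walks by blast+
  ultimately have "card ?V + 2 ^ n = 3 ^ n + 1" by linarith
  then have "int (card ?V + 2 ^ n) = int (3 ^ n + 1)" by (rule arg_cong)
  then have "int (card ?V) = 3 ^ n + 1 - 2 ^ n" by simp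
  then show ?thesis using count by simp
qed

section \<open>Sizes of bracelets and the growth rate\<close>

lemma bracelet_class_finite:
  assumes "u \<noteq> []"
  shows "finite (bracelet_rel `` {u})" "card (bracelet_rel `` {u}) \<le> 2 * length u"
proof -
  let ?l = "length u"
  let ?S = "(\<lambda>k. rotate k u) ` {..<?l} \<union> (\<lambda>k. rotate k (rev u)) ` {..<?l}"
  have sub: "bracelet_rel `` {u} \<subseteq> ?S"
  proof
    fix v assume "v \<in> bracelet_rel `` {u}"
    then obtain k where "v = rotate k u \<or> v = rotate k (rev u)" by (auto simp: bracelet_rel_def)
    then have "v = rotate (k mod ?l) u \<or> v = rotate (k mod ?l) (rev u)"
      by (metis length_rev rotate_conv_mod)
    moreover have "k mod ?l \<in> {..<?l}" using assms by simp
    ultimately show "v \<in> ?S" by blast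
  qed
  then show "finite (bracelet_rel `` {u})" by (rule finite_subset) simp
  have "card (bracelet_rel `` {u}) \<le> card ?S" using sub by (intro card_mono) auto
  also have "\<dots> \<le> card ((\<lambda>k. rotate k u) ` {..<?l}) + card ((\<lambda>k. rotate k (rev u)) ` {..<?l})"
    by (rule card_Un_le)
  also have "\<dots> \<le> ?l + ?l"
    using card_image_le[of "{..<?l}" "\<lambda>k. rotate k u"] card_image_le[of "{..<?l}" "\<lambda>k. rotate k (rev u)"]
    by simp
  finally show "card (bracelet_rel `` {u}) \<le> 2 * ?l" by simp
qed

lemma finite_realizable_words: "finite (realizable_words n)"
  by (rule finite_subset[OF _ card_binary_words(1)[of "2 * n"]]) (auto simp: realizable_words_def)

lemma realizable_bracelets_eq_image:
  "realizable_bracelets n = (\<lambda>u. bracelet_rel `` {u}) ` realizable_words n"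
  by (auto simp: realizable_bracelets_def quotient_def)

lemma card_realizable_bracelets_le: "card (realizable_bracelets n) \<le> card (realizable_words n)"
  unfolding realizable_bracelets_eq_image by (rule card_image_le[OF finite_realizable_words])

text \<open>The words are covered by their bracelets, each of which has at most two members (a word
  and a reversal) for every one of the \<open>2 * n\<close> rotations.\<close>

lemma card_realizable_words_le_bracelets:
  assumes "0 < n"
  shows "card (realizable_words n) \<le> 4 * n * card (realizable_bracelets n)"
proof -
  have ne: "u \<noteq> [] \<and> length u = 2 * n" if "u \<in> realizable_words n" for u
    using that assms by (auto simp: realizable_words_def binary_words_def)
  have cls: "finite C \<and> card C \<le> 4 * n" if C: "C \<in> realizable_bracelets n" for C
  proof -
    obtain u where "u \<in> realizable_words n" "C = bracelet_rel `` {u}"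
      using C by (auto simp: realizable_bracelets_eq_image)
    then show ?thesis using bracelet_class_finite[of u] ne[of u] by simp
  qed
  have "realizable_words n \<subseteq> \<Union> (realizable_bracelets n)"
    using equiv_class_self[OF equiv_bracelet_rel] by (auto simp: realizable_bracelets_eq_image)
  moreover have "finite (\<Union> (realizable_bracelets n))"
    using cls finite_realizable_words by (auto simp: realizable_bracelets_eq_image)
  ultimately have "card (realizable_words n) \<le> card (\<Union> (realizable_bracelets n))"
    by (intro card_mono)
  also have "\<dots> \<le> (\<Sum>C\<in>realizable_bracelets n. card C)" using cls by (intro card_Union_le_sum_card)
  also have "\<dots> \<le> of_nat (card (realizable_bracelets n)) * (4 * n)"
    using cls by (intro sum_bounded_above) blast
  finally show ?thesis by (simp add: mult.commute)
qed

text \<open>Leaves at least a quarter of 3^n after the subtraction of 2^(n + 1).\<close>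

lemma two_power_bound: "3 \<le> n \<Longrightarrow> 4 * (2::real) ^ (n + 1) \<le> 3 * 3 ^ n"
proof (induction n rule: dec_induct)
  case (step n)
  have "0 \<le> (3::real) ^ n" by simp
  with step show ?case unfolding power_Suc Suc_eq_plus1[symmetric] by linarith
qed simp

theorem corollary3:
  "(\<forall>n\<ge>3. int (card (realizable_words n)) = 3 ^ n - 2 ^ (n + 1) + 1) \<and>
   (\<exists>\<epsilon> :: nat \<Rightarrow> real. \<epsilon> \<in> o(\<lambda>_. 1) \<and>
      (\<forall>\<^sub>F n in sequentially.
         real (card (realizable_bracelets n)) = 3 powr (real n * (1 + \<epsilon> n))))"
proof (intro conjI)
  show words: "\<forall>n\<ge>3. int (card (realizable_words n)) = 3 ^ n - 2 ^ (n + 1) + 1"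
    using realizable_words_eq card_balanced_words by simp
  define b where "b n = real (card (realizable_bracelets n))" for n
  \<comment> \<open>The only solution of \<open>b n = 3 powr (real n * (1 + \<epsilon> n))\<close>
    when \<open>b n\<close> and \<open>n\<close> are positive; it remains to see that it tends to
    0.\<close>
  define \<epsilon> where "\<epsilon> n = log 3 (b n) / real n - 1" for n
  \<comment> \<open>The factor \<open>16 * n\<close> is 4 from \<open>two_power_bound\<close> times
    \<open>4 * n\<close> from the size of a bracelet.\<close>
  have upper: "b n \<le> 3 ^ n" and lower: "3 ^ n / (16 * real n) \<le> b n" if n: "3 \<le> n" for n
  proof -
    have "real_of_int (int (card (realizable_words n))) = real_of_int (3 ^ n - 2 ^ (n + 1) + 1)"
      using words n by simp
    then have w: "real (card (realizable_words n)) = 3 ^ n - 2 ^ (n + 1) + 1" by simp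
    have "b n \<le> real (card (realizable_words n))"
      using card_realizable_bracelets_le by (simp add: b_def)
    also have "\<dots> \<le> 3 ^ n" using one_le_power[of "2::real" "n + 1"] unfolding w by simp
    finally show "b n \<le> 3 ^ n" .
    have "3 ^ n / 4 \<le> real (card (realizable_words n))" using two_power_bound[OF n] unfolding w by simp
    also have "\<dots> \<le> real (4 * n * card (realizable_bracelets n))"
      using card_realizable_words_le_bracelets[of n] n by (intro of_nat_mono) auto
    also have "\<dots> = 4 * real n * b n" by (simp add: b_def)
    finally show "3 ^ n / (16 * real n) \<le> b n" using n by (simp add: field_simps)
  qed
  have b_pos: "0 < b n" if "3 \<le> n" for n
    using lower[OF that] that by (rule_tac less_le_trans[of _ "3 ^ n / (16 * real n)"]) auto
  have upper_\<epsilon>: "\<epsilon> n \<le> 0" and lower_\<epsilon>: "- (log 3 16 / real n + ln (real n) / real n / ln 3) \<le> \<epsilon> n"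
    if n: "3 \<le> n" for n
  proof -
    have "log 3 (b n) \<le> log 3 (3 ^ n)" using upper[OF n] b_pos[OF n] by (subst log_le_cancel_iff) auto
    then have "log 3 (b n) \<le> real n" by (simp add: log_nat_power)
    then show "\<epsilon> n \<le> 0" using n by (simp add: \<epsilon>_def field_simps)
    have "log 3 (3 ^ n / (16 * real n)) \<le> log 3 (b n)"
      using lower[OF n] n b_pos[OF n] by (subst log_le_cancel_iff) auto
    moreover have "log 3 (3 ^ n / (16 * real n)) = real n - (log 3 16 + ln (real n) / ln 3)"
      using n by (simp add: log_divide log_mult log_nat_power) (simp add: log_def)
    ultimately have "real n - (log 3 16 + ln (real n) / ln 3) \<le> log 3 (b n)" by simp
    then have "(real n - (log 3 16 + ln (real n) / ln 3)) / real n \<le> log 3 (b n) / real n"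
      by (intro divide_right_mono) auto
    moreover have "(real n - (log 3 16 + ln (real n) / ln 3)) / real n =
        1 - (log 3 16 / real n + ln (real n) / real n / ln 3)" using n by (simp add: field_simps)
    ultimately show "- (log 3 16 / real n + ln (real n) / real n / ln 3) \<le> \<epsilon> n" by (simp add: \<epsilon>_def)
  qed
  \<comment> \<open>After taking logarithms and dividing by \<open>n\<close>, the factor
    \<open>16 * n\<close> costs only a term of order ln n / n.\<close>
  have "(\<lambda>n. - (log 3 16 / real n + ln (real n) / real n / ln 3)) \<longlonglongrightarrow> - (0 + 0 / ln 3)"
    by (intro tendsto_minus tendsto_add tendsto_divide lim_ln_over_n lim_const_over_n tendsto_const) auto
  then have lim: "(\<lambda>n. - (log 3 16 / real n + ln (real n) / real n / ln 3)) \<longlonglongrightarrow> 0" by simp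
  have "\<epsilon> \<longlonglongrightarrow> 0"
    by (rule tendsto_sandwich[OF _ _ lim tendsto_const])
      (use upper_\<epsilon> lower_\<epsilon> in \<open>auto simp: eventually_sequentially\<close>)
  then have "\<epsilon> \<in> o(\<lambda>_. 1)" by (intro smalloI_tendsto) auto
  moreover have "\<forall>\<^sub>F n in sequentially. b n = 3 powr (real n * (1 + \<epsilon> n))"
    unfolding eventually_sequentially
  proof (intro exI[of _ 3] allI impI)
    fix n :: nat assume n: "3 \<le> n"
    then have "real n * (1 + \<epsilon> n) = log 3 (b n)" by (simp add: \<epsilon>_def)
    then show "b n = 3 powr (real n * (1 + \<epsilon> n))" using b_pos[OF n] by simp
  qed
  ultimately show "\<exists>\<epsilon> :: nat \<Rightarrow> real. \<epsilon> \<in> o(\<lambda>_. 1) \<and>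
      (\<forall>\<^sub>F n in sequentially.
         real (card (realizable_bracelets n)) = 3 powr (real n * (1 + \<epsilon> n)))"
    unfolding b_def by blast
qed

end
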